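(* It can be decided in polynomial time whether the vertices of a given loop-free digraph can be ordered such that the left-going arcs form a Hamiltonian dipath.
   Context: Digraphs are finite and loop-free; parallel arcs are allowed. For an ordering $\sigma=(\sigma_1,\dots,\sigma_n)$ of the vertices, an arc from $\sigma_i$ to $\sigma_j$ is left-going if $j<i$. A Hamiltonian dipath is a directed path containing every vertex of the digraph exactly once; the requirement is that the set of all left-going arcs is exactly the arc set of such a path. *)

theory Defs
  imports "Graph_Theory.Graph_Theory" "HOL-Computational_Algebra.Polynomial"
begin

section \<open>Left-going arcs and Hamiltonian dipaths\<close>

definition vertex_ordering :: "('a, 'b) pre_digraph \<Rightarrow> 'a list \<Rightarrow> bool" where
  "vertex_ordering G \<sigma> \<longleftrightarrow> distinct \<sigma> \<and> set \<sigma> = verts G"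

definition left_going_arcs :: "('a, 'b) pre_digraph \<Rightarrow> 'a list \<Rightarrow> 'b set" where
  "left_going_arcs G \<sigma> =
     {a \<in> arcs G. \<exists>i j. j < i \<and> i < length \<sigma> \<and> tail G a = \<sigma> ! i \<and> head G a = \<sigma> ! j}"

text \<open>
  Paths are sequences of arcs, so parallel arcs are distinguished: if an arc of the path has a
  parallel copy, that copy is not an arc of the path. A path has at least one vertex; hence the
  digraph without vertices has no Hamiltonian dipath.
\<close>

definition hamiltonian_dipath :: "('a, 'b) pre_digraph \<Rightarrow> 'a \<Rightarrow> 'b awalk \<Rightarrow> 'a \<Rightarrow> bool" where
  "hamiltonian_dipath G u p v \<longleftrightarrow>
     pre_digraph.apath G u p v \<and> set (pre_digraph.awalk_verts G u p) = verts G"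

definition left_going_hamiltonian :: "('a, 'b) pre_digraph \<Rightarrow> bool" where
  "left_going_hamiltonian G \<longleftrightarrow>
     (\<exists>\<sigma>. vertex_ordering G \<sigma> \<and>
       (\<exists>u p v. hamiltonian_dipath G u p v \<and> left_going_arcs G \<sigma> = set p))"


section \<open>Digraphs as input words\<close>

text \<open>
  Inputs are digraphs with vertices \<open>0, \<dots>, n - 1\<close> and a list of arcs, given as
  (tail, head) pairs; repeated pairs are parallel arcs. The list may also contain loops or pairs
  that are out of range; such lists are excluded where languages are formed. By
  \<open>ex_digraph_iso_digraph_of\<close> below, every finite digraph has this form up to isomorphism.
\<close>

definition digraph_of :: "nat \<Rightarrow> (nat \<times> nat) list \<Rightarrow> (nat, nat) pre_digraph" where
  "digraph_of n es =
     \<lparr>verts = {..<n}, arcs = {..<length es}, tail = \<lambda>a. fst (es ! a), head = \<lambda>a. snd (es ! a)\<rparr>"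

text \<open>
  A number \<open>x\<close> is written as \<open>x\<close> ones followed by a zero. With \<open>n\<close> vertices and \<open>m\<close> arcs, the
  resulting word has length at least \<open>n + m\<close> and at most \<open>n + 1 + 2 * m * n\<close>, so being polynomial
  in its length is the same as being polynomial in \<open>n + m\<close>.
\<close>

definition encode_nat :: "nat \<Rightarrow> bool list" where
  "encode_nat x = replicate x True @ [False]"

definition encode_digraph :: "nat \<Rightarrow> (nat \<times> nat) list \<Rightarrow> bool list" where
  "encode_digraph n es =
     encode_nat n @ concat (map (\<lambda>(u, v). encode_nat u @ encode_nat v) es)"

definition left_going_hamiltonian_language :: "bool list set" where
  "left_going_hamiltonian_language =
     {encode_digraph n es | n es.
        fin_digraph (digraph_of n es) \<and> loopfree_digraph (digraph_of n es) \<and>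
        left_going_hamiltonian (digraph_of n es)}"


section \<open>Polynomial time\<close>

text \<open>
  Deterministic Turing machines with \<open>num_tapes\<close> two-way infinite tapes. States are the numbers
  below \<open>num_states\<close>, tape symbols the numbers below \<open>num_symbols\<close>, where \<open>0\<close> is the blank and
  \<open>1\<close>, \<open>2\<close> are the input bits. In one step the machine reads the symbols under all heads, changes
  its state, and on every tape writes a symbol and moves the head by at most one cell.
\<close>

datatype move = MoveLeft | Stay | MoveRight

record tm =
  num_tapes :: nat
  num_states :: nat
  num_symbols :: nat
  start_state :: nat
  accept_state :: nat
  reject_state :: nat
  transition :: "nat \<Rightarrow> nat list \<Rightarrow> nat \<times> (nat \<times> move) list"

definition wf_tm :: "tm \<Rightarrow> bool" where
  "wf_tm M \<longleftrightarrow>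
     1 \<le> num_tapes M \<and> 3 \<le> num_symbols M \<and>
     start_state M < num_states M \<and> accept_state M < num_states M \<and>
     reject_state M < num_states M \<and> accept_state M \<noteq> reject_state M \<and>
     (\<forall>q ss q' as.
        q < num_states M \<longrightarrow> length ss = num_tapes M \<longrightarrow> (\<forall>s \<in> set ss. s < num_symbols M) \<longrightarrow>
        transition M q ss = (q', as) \<longrightarrow>
        q' < num_states M \<and> length as = num_tapes M \<and> (\<forall>(s, d) \<in> set as. s < num_symbols M))"

text \<open>A tape is the position of its head together with its contents.\<close>

type_synonym tape = "int \<times> (int \<Rightarrow> nat)"
type_synonym tm_config = "nat \<times> tape list"

definition read_tape :: "tape \<Rightarrow> nat" where
  "read_tape t = snd t (fst t)"

fun move_offset :: "move \<Rightarrow> int" where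
  "move_offset MoveLeft = - 1"
| "move_offset Stay = 0"
| "move_offset MoveRight = 1"

definition act_tape :: "nat \<times> move \<Rightarrow> tape \<Rightarrow> tape" where
  "act_tape a t = (fst t + move_offset (snd a), (snd t)(fst t := fst a))"

definition tm_step :: "tm \<Rightarrow> tm_config \<Rightarrow> tm_config" where
  "tm_step M = (\<lambda>(q, ts).
     if q = accept_state M \<or> q = reject_state M then (q, ts)
     else let (q', as) = transition M q (map read_tape ts)
          in (q', map2 act_tape as ts))"

definition blank_tape :: tape where
  "blank_tape = (0, \<lambda>_. 0)"

definition input_tape :: "bool list \<Rightarrow> tape" where
  "input_tape w =
     (0, \<lambda>i. if 0 \<le> i \<and> i < int (length w) then (if w ! nat i then 2 else 1) else 0)"

definition tm_init :: "tm \<Rightarrow> bool list \<Rightarrow> tm_config" where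
  "tm_init M w = (start_state M, input_tape w # replicate (num_tapes M - 1) blank_tape)"

definition decides_in_time :: "tm \<Rightarrow> bool list set \<Rightarrow> (nat \<Rightarrow> nat) \<Rightarrow> bool" where
  "decides_in_time M L T \<longleftrightarrow>
     (\<forall>w. \<exists>t \<le> T (length w).
        fst ((tm_step M ^^ t) (tm_init M w)) = (if w \<in> L then accept_state M else reject_state M))"

definition polynomial_time :: "bool list set set" where
  "polynomial_time = {L. \<exists>M (p :: nat poly). wf_tm M \<and> decides_in_time M L (poly p)}"


section \<open>Adequacy of the encoding\<close>

lemma replicate_False_append_eq:
  "replicate x True @ False # ys = replicate x' True @ False # ys' \<longleftrightarrow> x = x' \<and> ys = ys'"
proof (induction x arbitrary: x')
  case 0
  then show ?case by (cases x') auto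
next
  case (Suc x)
  then show ?case by (cases x') auto
qed

lemma encode_digraph_inject:
  "encode_digraph n es = encode_digraph n' es' \<longleftrightarrow> n = n' \<and> es = es'"
proof -
  have "concat (map (\<lambda>(u, v). encode_nat u @ encode_nat v) es) =
        concat (map (\<lambda>(u, v). encode_nat u @ encode_nat v) es') \<Longrightarrow> es = es'"
  proof (induction es arbitrary: es')
    case Nil
    then show ?case by (cases es') (auto simp: encode_nat_def)
  next
    case (Cons e es)
    then show ?case
      by (cases es'; cases e) (auto simp: encode_nat_def replicate_False_append_eq)
  qed
  then show ?thesis
    by (auto simp: encode_digraph_def encode_nat_def replicate_False_append_eq)
qed

lemma ex_digraph_iso_digraph_of:
  assumes "fin_digraph G"
  shows "\<exists>n es. digraph_iso G (digraph_of n es)"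
proof -
  interpret fin_digraph G by fact
  obtain f where f: "bij_betw f (verts G) {..<card (verts G)}"
    using ex_bij_betw_finite_nat[OF finite_verts] by (auto simp: atLeast0LessThan)
  obtain g where g: "bij_betw g (arcs G) {..<card (arcs G)}"
    using ex_bij_betw_finite_nat[OF finite_arcs] by (auto simp: atLeast0LessThan)
  define h where "h = inv_into (arcs G) g"
  define es where "es = map (\<lambda>a. (f (tail G (h a)), f (head G (h a)))) [0..<card (arcs G)]"
  define hom where
    "hom = \<lparr>iso_verts = f, iso_arcs = g, iso_head = \<lambda>a. snd (es ! a), iso_tail = \<lambda>a. fst (es ! a)\<rparr>"
  have lt: "g a < card (arcs G)" if "a \<in> arcs G" for a
    using g that by (auto simp: bij_betw_def)
  have h: "h (g a) = a" if "a \<in> arcs G" for a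
    using g that by (simp add: h_def bij_betw_def)
  have "digraph_isomorphism hom"
    unfolding digraph_isomorphism_def
    using f g lt h wf_digraph_axioms by (auto simp: hom_def es_def bij_betw_def)
  moreover have "app_iso hom G = digraph_of (card (verts G)) es"
    using f g by (simp add: app_iso_def digraph_of_def hom_def es_def bij_betw_def)
  ultimately show ?thesis
    unfolding digraph_iso_def by metis
qed

end

theory Submission
  imports Defs
begin

text \<open>
  Reverse the ordering: the left-going arcs form a Hamiltonian dipath iff the vertices can be
  listed as \<open>v\<^sub>1, \<dots>, v\<^sub>n\<close> such that each \<open>v\<^sub>i\<close> with \<open>i < n\<close> has exactly one arc, counted with
  multiplicity, to the later vertices, this arc goes to \<open>v\<^sub>i\<^sub>+\<^sub>1\<close>, and \<open>n \<ge> 1\<close>. The first vertex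
  thus determines all others: from the current vertex there must be exactly one arc to an unvisited
  vertex, which becomes the next one. It suffices to run this greedy search from each start vertex
  (\<open>left_going_hamiltonian_iff_extends\<close>).

  For the time bound, programs with loops over finitely many tapes are translated into Turing
  machines, such that a run of \<open>t\<close> steps of the program is a run of \<open>t\<close> steps of the machine
  (\<open>exec_control_path\<close>, \<open>polynomial_timeI\<close>). The greedy search is written as such a program. One
  tape holds a mark for each vertex, and numbers in unary are looked up by moving its head
  (\<open>runs_scan_arc\<close>). One pass over the input finds the next vertex (\<open>runs_pass\<close>) in time linear in
  the length \<open>N\<close> of the input; there are at most \<open>N\<close> passes for each of at most \<open>N\<close> start vertices
  (\<open>runs_greedy\<close>, \<open>runs_try_all\<close>, \<open>runs_decide\<close>), so the total time is cubic.

  The input is not validated beforehand. Each pass reads all arcs and fails on malformed words, on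
  arcs that are out of range and on loops at the current vertex; as every vertex becomes current in
  a successful search, no loop is missed.
\<close>

section \<open>Programs on tapes and Turing machines\<close>

text \<open>
  Tapes are addressed by numbers. \<open>Cond i S c c'\<close> and \<open>Loop i S c\<close> test whether the symbol under
  the head of tape \<open>i\<close> lies in \<open>S\<close>.
\<close>

datatype com =
    Skip
  | Write nat nat
  | Move nat move
  | Seq com com  (infixr ";;" 60)
  | Cond nat "nat set" com com
  | Loop nat "nat set" com

text \<open>
  A memory holds infinitely many tapes; a machine with \<open>k\<close> tapes has only the first \<open>k\<close> of them.
\<close>

type_synonym memory = "nat \<Rightarrow> tape"

definition put :: "nat \<Rightarrow> tape \<Rightarrow> tape" where
  "put s t = (fst t, (snd t)(fst t := s))"

definition shift :: "move \<Rightarrow> tape \<Rightarrow> tape" where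
  "shift d t = (fst t + move_offset d, snd t)"

text \<open>
  \<open>exec c t m m'\<close>: started in memory \<open>m\<close>, the program \<open>c\<close> stops after exactly \<open>t\<close> steps in memory \<open>m'\<close>.
  Each write, head movement and test costs one step.
\<close>

inductive exec :: "com \<Rightarrow> nat \<Rightarrow> memory \<Rightarrow> memory \<Rightarrow> bool" where
  Skip: "exec Skip 0 m m"
| Write: "exec (Write i s) 1 m (m(i := put s (m i)))"
| Move: "exec (Move i d) 1 m (m(i := shift d (m i)))"
| Seq: "exec c t m m' \<Longrightarrow> exec c' t' m' m'' \<Longrightarrow> exec (c ;; c') (t + t') m m''"
| CondT: "read_tape (m i) \<in> S \<Longrightarrow> exec c t m m' \<Longrightarrow> exec (Cond i S c c') (Suc t) m m'"
| CondF: "read_tape (m i) \<notin> S \<Longrightarrow> exec c' t m m' \<Longrightarrow> exec (Cond i S c c') (Suc t) m m'"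
| LoopF: "read_tape (m i) \<notin> S \<Longrightarrow> exec (Loop i S c) 1 m m"
| LoopT: "read_tape (m i) \<in> S \<Longrightarrow> exec c t m m' \<Longrightarrow> exec (Loop i S c) t' m' m'' \<Longrightarrow>
    exec (Loop i S c) (Suc (t + t')) m m''"

inductive_cases exec_SkipE: "exec Skip t m m'"
inductive_cases exec_WriteE: "exec (Write i s) t m m'"
inductive_cases exec_MoveE: "exec (Move i d) t m m'"
inductive_cases exec_SeqE: "exec (c ;; c') t m m'"
inductive_cases exec_CondE: "exec (Cond i S c c') t m m'"

text \<open>
  The control states of \<open>c\<close> are the numbers below \<open>num_labels c\<close>; \<open>0\<close> is the entry and
  \<open>num_labels c\<close> itself is the exit. For \<open>Skip\<close>, entry and exit coincide.
\<close>

fun num_labels :: "com \<Rightarrow> nat" where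
  "num_labels Skip = 0"
| "num_labels (Write i s) = 1"
| "num_labels (Move i d) = 1"
| "num_labels (c ;; c') = num_labels c + num_labels c'"
| "num_labels (Cond i S c c') = Suc (num_labels c + num_labels c')"
| "num_labels (Loop i S c) = Suc (num_labels c)"

text \<open>
  Renumbering of a subprogram with \<open>n\<close> labels that is placed after one test: labels move up by
  one, and the exit is sent to \<open>e\<close>.
\<close>

definition redirect :: "nat \<Rightarrow> nat \<Rightarrow> nat \<Rightarrow> nat" where
  "redirect n e q = (if q = n then e else Suc q)"

text \<open>
  The control of \<open>c\<close> in state \<open>q\<close>, when \<open>r j\<close> is the symbol read on tape \<open>j\<close>: the next state, and
  for each tape the symbol to write and the head movement. Writing \<open>r j\<close> back leaves tape \<open>j\<close>
  unchanged.
\<close>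

fun control :: "com \<Rightarrow> nat \<Rightarrow> (nat \<Rightarrow> nat) \<Rightarrow> nat \<times> (nat \<Rightarrow> nat \<times> move)" where
  "control Skip q r = (0, \<lambda>j. (r j, Stay))"
| "control (Write i s) q r = (1, (\<lambda>j. (r j, Stay))(i := (s, Stay)))"
| "control (Move i d) q r = (1, (\<lambda>j. (r j, Stay))(i := (r i, d)))"
| "control (c ;; c') q r =
     (if q < num_labels c then control c q r
      else apfst (\<lambda>q'. num_labels c + q') (control c' (q - num_labels c) r))"
| "control (Cond i S c c') q r =
     (let e = Suc (num_labels c + num_labels c') in
      if q = 0 then
        (if r i \<in> S then redirect (num_labels c) e 0 else Suc (num_labels c), \<lambda>j. (r j, Stay))
      else if q \<le> num_labels c then
        apfst (redirect (num_labels c) e) (control c (q - 1) r)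
      else apfst (\<lambda>q'. Suc (num_labels c + q')) (control c' (q - Suc (num_labels c)) r))"
| "control (Loop i S c) q r =
     (if q = 0 then
        (if r i \<in> S then redirect (num_labels c) 0 0 else Suc (num_labels c), \<lambda>j. (r j, Stay))
      else apfst (redirect (num_labels c) 0) (control c (q - 1) r))"

definition control_step :: "com \<Rightarrow> nat \<times> memory \<Rightarrow> nat \<times> memory" where
  "control_step c = (\<lambda>(q, m).
     let (q', a) = control c q (\<lambda>j. read_tape (m j)) in (q', \<lambda>j. act_tape (a j) (m j)))"

text \<open>
  \<open>control_path c t x y\<close>: \<open>t\<close> control steps lead from \<open>x\<close> to \<open>y\<close>, and no state before \<open>y\<close> is the exit
  of \<open>c\<close>. This side condition allows a path of a subprogram to be replayed inside a larger one.
\<close>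

fun control_path :: "com \<Rightarrow> nat \<Rightarrow> nat \<times> memory \<Rightarrow> nat \<times> memory \<Rightarrow> bool" where
  "control_path c 0 x y \<longleftrightarrow> x = y"
| "control_path c (Suc t) x y \<longleftrightarrow> fst x < num_labels c \<and> control_path c t (control_step c x) y"

lemma control_path_trans:
  "control_path c t x y \<Longrightarrow> control_path c t' y z \<Longrightarrow> control_path c (t + t') x z"
  by (induction t arbitrary: x) auto

lemma control_path_embed:
  assumes "\<And>q r. q < num_labels c \<Longrightarrow>
      f q < num_labels c' \<and> control c' (f q) r = apfst f (control c q r)"
    and "control_path c t (q, m) (q', m')"
  shows "control_path c' t (f q, m) (f q', m')"
  using assms(2)
proof (induction t arbitrary: q m)
  case 0
  then show ?case by simp
next
  case (Suc t)
  then have q: "q < num_labels c" by simp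
  obtain q1 m1 where s: "control_step c (q, m) = (q1, m1)" by fastforce
  have "control_step c' (f q, m) = (f q1, m1)"
    using s assms(1)[OF q] by (auto simp: control_step_def split: prod.splits)
  then show ?case using Suc assms(1)[OF q] s by auto
qed

lemma act_tape_read_Stay [simp]: "act_tape (read_tape t, Stay) t = t"
  by (simp add: act_tape_def read_tape_def)

lemma act_tape_read: "act_tape (read_tape t, d) t = shift d t"
  by (simp add: act_tape_def read_tape_def shift_def)

lemma put_read_tape [simp]: "put (read_tape t) t = t"
  by (simp add: put_def read_tape_def)

lemma shift_Stay [simp]: "shift Stay t = t"
  by (simp add: shift_def)

lemma act_tape_Stay: "act_tape (s, Stay) t = put s t"
  by (simp add: act_tape_def put_def)

lemma exec_control_path: "exec c t m m' \<Longrightarrow> control_path c t (0, m) (num_labels c, m')"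
proof (induction rule: exec.induct)
  case (Skip m)
  then show ?case by simp
next
  case (Write i s m)
  then show ?case by (auto simp: control_step_def act_tape_Stay fun_eq_iff)
next
  case (Move i d m)
  then show ?case by (auto simp: control_step_def act_tape_read fun_eq_iff)
next
  case (Seq c t m m' c' t' m'')
  have 1: "control_path (c ;; c') t (0, m) (num_labels c, m')"
    by (rule control_path_embed[where f = "\<lambda>q. q", OF _ Seq.IH(1)]) (auto simp: apfst_def map_prod_def)
  have "control_path (c ;; c') t' (num_labels c + 0, m') (num_labels c + num_labels c', m'')"
    by (rule control_path_embed[where f = "\<lambda>q. num_labels c + q", OF _ Seq.IH(2)]) auto
  with 1 show ?case by (auto intro: control_path_trans)
next
  case (CondT m i S c t m' c')
  let ?e = "Suc (num_labels c + num_labels c')"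
  have "control_path (Cond i S c c') t (redirect (num_labels c) ?e 0, m)
     (redirect (num_labels c) ?e (num_labels c), m')"
    by (rule control_path_embed[OF _ CondT.IH]) (auto simp: redirect_def)
  then show ?case using CondT.hyps by (simp add: control_step_def redirect_def)
next
  case (CondF m i S c' t m' c)
  have "control_path (Cond i S c c') t (Suc (num_labels c + 0), m) (Suc (num_labels c + num_labels c'), m')"
    by (rule control_path_embed[where f = "\<lambda>q. Suc (num_labels c + q)", OF _ CondF.IH]) auto
  then show ?case using CondF.hyps by (simp add: control_step_def)
next
  case (LoopF m i S c)
  then show ?case by (simp add: control_step_def)
next
  case (LoopT m i S c t m' t' m'')
  have "control_path (Loop i S c) t (redirect (num_labels c) 0 0, m)
     (redirect (num_labels c) 0 (num_labels c), m')"
    by (rule control_path_embed[OF _ LoopT.IH(1)]) (auto simp: redirect_def)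
  then have "control_path (Loop i S c) t (redirect (num_labels c) 0 0, m) (0, m')"
    by (simp add: redirect_def)
  then show ?case using LoopT.hyps LoopT.IH(2) control_path_trans
    by (fastforce simp: control_step_def)
qed

text \<open>
  The program uses only tapes below \<open>k\<close> and writes only symbols below \<open>n\<close>.
\<close>

fun bounded_com :: "nat \<Rightarrow> nat \<Rightarrow> com \<Rightarrow> bool" where
  "bounded_com k n Skip \<longleftrightarrow> True"
| "bounded_com k n (Write i s) \<longleftrightarrow> i < k \<and> s < n"
| "bounded_com k n (Move i d) \<longleftrightarrow> i < k"
| "bounded_com k n (c ;; c') \<longleftrightarrow> bounded_com k n c \<and> bounded_com k n c'"
| "bounded_com k n (Cond i S c c') \<longleftrightarrow> i < k \<and> bounded_com k n c \<and> bounded_com k n c'"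
| "bounded_com k n (Loop i S c) \<longleftrightarrow> i < k \<and> bounded_com k n c"

lemma control_label_le: "q < num_labels c \<Longrightarrow> fst (control c q r) \<le> num_labels c"
proof (induction c arbitrary: q)
  case (Cond i S c1 c2)
  have "fst (control c1 (q - 1) r) \<le> num_labels c1" if "q \<le> num_labels c1" "q \<noteq> 0"
    using that Cond.IH(1)[of "q - 1"] by auto
  moreover have "fst (control c2 (q - Suc (num_labels c1)) r) \<le> num_labels c2"
    if "\<not> q \<le> num_labels c1"
    using that Cond.prems by (intro Cond.IH(2)) auto
  ultimately show ?case by (auto simp: redirect_def Let_def)
next
  case (Loop i S c)
  have "fst (control c (q - 1) r) \<le> num_labels c" if "q \<noteq> 0"
    using that Loop by auto
  then show ?case by (auto simp: redirect_def)
next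
  case (Seq c1 c2)
  have "fst (control c2 (q - num_labels c1) r) \<le> num_labels c2" if "\<not> q < num_labels c1"
    using that Seq.prems by (intro Seq.IH(2)) auto
  then show ?case using Seq.IH(1)[of q] by auto
qed auto

lemma control_symbol_less:
  "bounded_com k n c \<Longrightarrow> (\<And>j. j < k \<Longrightarrow> r j < n) \<Longrightarrow> j < k \<Longrightarrow> fst (snd (control c q r) j) < n"
  by (induction c arbitrary: q) (auto simp: Let_def)

lemma control_cong:
  "bounded_com k n c \<Longrightarrow> (\<And>j. j < k \<Longrightarrow> r j = r' j) \<Longrightarrow>
   fst (control c q r) = fst (control c q r') \<and>
   (\<forall>j<k. snd (control c q r) j = snd (control c q r') j)"
  by (induction c arbitrary: q) (auto simp: Let_def)

text \<open>
  The machine runs \<open>c\<close>; at the exit of \<open>c\<close> one more step accepts if the symbol on tape \<open>i\<close> is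
  \<open>1\<close> and rejects otherwise.
\<close>

definition machine_of :: "nat \<Rightarrow> nat \<Rightarrow> nat \<Rightarrow> com \<Rightarrow> tm" where
  "machine_of k n i c =
    \<lparr>num_tapes = k, num_states = num_labels c + 3, num_symbols = n, start_state = 0,
     accept_state = Suc (num_labels c), reject_state = Suc (Suc (num_labels c)),
     transition = \<lambda>q ss.
       if q < num_labels c then
         let (q', a) = control c q (\<lambda>j. ss ! j) in (q', map a [0..<k])
       else (Suc (num_labels c) + of_bool (ss ! i \<noteq> 1), map (\<lambda>s. (s, Stay)) ss)\<rparr>"

lemma wf_tm_machine_of:
  assumes "bounded_com k n c" "1 \<le> k" "3 \<le> n"
  shows "wf_tm (machine_of k n i c)"
proof -
  have *: "q' < num_labels c + 3 \<and> length as = k \<and> (\<forall>(s, d) \<in> set as. s < n)"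
    if q: "q < num_labels c + 3" and ss: "length ss = k" "\<forall>s \<in> set ss. s < n"
      and tr: "transition (machine_of k n i c) q ss = (q', as)" for q ss q' as
  proof (cases "q < num_labels c")
    case True
    let ?C = "control c q (\<lambda>j. ss ! j)"
    have eq: "q' = fst ?C" "as = map (snd ?C) [0..<k]"
      using tr True by (auto simp: machine_of_def split: prod.splits)
    have "fst (snd ?C j) < n" if "j < k" for j
      using assms(1) that ss by (intro control_symbol_less[of k n c]) auto
    then show ?thesis
      using control_label_le[OF True, of "\<lambda>j. ss ! j"] unfolding eq by (auto simp: case_prod_beta)
  next
    case False
    then show ?thesis using tr ss by (auto simp: machine_of_def)
  qed
  show ?thesis
    unfolding wf_tm_def using assms * by (simp add: machine_of_def)
qed

lemma machine_of_step:
  assumes "bounded_com k n c" "q < num_labels c"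
  shows "tm_step (machine_of k n i c) (q, map m [0..<k]) =
    (fst (control_step c (q, m)), map (snd (control_step c (q, m))) [0..<k])"
proof -
  let ?r = "\<lambda>j. map read_tape (map m [0..<k]) ! j" and ?r' = "\<lambda>j. read_tape (m j)"
  have cong: "fst (control c q ?r) = fst (control c q ?r')"
    "\<And>j. j < k \<Longrightarrow> snd (control c q ?r) j = snd (control c q ?r') j"
    using control_cong[OF assms(1), of ?r ?r'] by auto
  have "map2 act_tape (map (snd (control c q ?r)) [0..<k]) (map m [0..<k]) =
      map (\<lambda>j. act_tape (snd (control c q ?r') j) (m j)) [0..<k]"
    by (rule nth_equalityI) (auto simp: cong[simplified])
  then show ?thesis
    using assms(2) cong(1)
    by (simp add: tm_step_def machine_of_def control_step_def case_prod_beta comp_def)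
qed

lemma machine_of_path:
  assumes "bounded_com k n c" "control_path c t (q, m) (q', m')"
  shows "(tm_step (machine_of k n i c) ^^ t) (q, map m [0..<k]) = (q', map m' [0..<k])"
  using assms(2)
proof (induction t arbitrary: q m)
  case (Suc t)
  obtain q1 m1 where s: "control_step c (q, m) = (q1, m1)" by fastforce
  then show ?case
    using Suc machine_of_step[OF assms(1), of q i m] by (simp add: funpow_swap1 del: funpow.simps) (simp add: funpow_Suc_right del: funpow.simps)
qed simp

lemma machine_of_exec:
  assumes "bounded_com k n c" "exec c t m m'" "i < k"
  shows "fst ((tm_step (machine_of k n i c) ^^ Suc t) (0, map m [0..<k])) =
    (if read_tape (m' i) = 1 then accept_state (machine_of k n i c)
     else reject_state (machine_of k n i c))"
  using machine_of_path[OF assms(1) exec_control_path[OF assms(2)], of i] assms(3)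
  by (simp add: tm_step_def machine_of_def)

text \<open>
  The strict bound pays for the final accepting or rejecting step.
\<close>

lemma polynomial_timeI:
  assumes c: "bounded_com k n c" "i < k" "3 \<le> n"
    and run: "\<And>w. \<exists>t m m'. t < poly p (length w) \<and> exec c t m m' \<and>
      map m [0..<k] = input_tape w # replicate (k - 1) blank_tape \<and>
      (read_tape (m' i) = 1 \<longleftrightarrow> w \<in> L)"
  shows "L \<in> polynomial_time"
proof -
  let ?M = "machine_of k n i c"
  have "\<exists>t \<le> poly p (length w). fst ((tm_step ?M ^^ t) (tm_init ?M w)) =
      (if w \<in> L then accept_state ?M else reject_state ?M)" for w
  proof -
    obtain t m m' where t: "t < poly p (length w)" "exec c t m m'"
      "map m [0..<k] = input_tape w # replicate (k - 1) blank_tape"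
      "read_tape (m' i) = 1 \<longleftrightarrow> w \<in> L"
      using run[of w] by auto
    have "tm_init ?M w = (0, map m [0..<k])"
      by (simp add: tm_init_def t(3)) (simp add: machine_of_def)
    then show ?thesis
      using machine_of_exec[OF c(1) t(2) c(2)] t by (intro exI[of _ "Suc t"]) auto
  qed
  then have "decides_in_time ?M L (poly p)" by (simp add: decides_in_time_def)
  moreover have "wf_tm ?M" using c by (intro wf_tm_machine_of) auto
  ultimately show ?thesis by (auto simp: polynomial_time_def)
qed

section \<open>Time-bounded runs\<close>

text \<open>
  \<open>runs c T m m'\<close>: from \<open>m\<close>, the program \<open>c\<close> reaches \<open>m'\<close> within \<open>T\<close> steps. The simplification rules
  below execute programs without loops symbolically.
\<close>

definition runs :: "com \<Rightarrow> nat \<Rightarrow> memory \<Rightarrow> memory \<Rightarrow> bool" where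
  "runs c T m m' \<longleftrightarrow> (\<exists>t\<le>T. exec c t m m')"

lemma runs_mono: "runs c T m m' \<Longrightarrow> T \<le> T' \<Longrightarrow> runs c T' m m'"
  by (auto simp: runs_def intro: order_trans)

lemma runs_Seq: "runs c T m m' \<Longrightarrow> runs c' T' m' m'' \<Longrightarrow> T + T' \<le> U \<Longrightarrow> runs (c ;; c') U m m''"
  unfolding runs_def using exec.Seq add_mono order_trans by meson

lemma runs_LoopF: "read_tape (m i) \<notin> S \<Longrightarrow> 0 < T \<Longrightarrow> runs (Loop i S c) T m m"
  by (auto simp: runs_def intro!: exI[of _ 1] exec.LoopF)

lemma runs_LoopT:
  assumes "read_tape (m i) \<in> S" "runs c T m m'" "runs (Loop i S c) T' m' m''" "Suc (T + T') \<le> U"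
  shows "runs (Loop i S c) U m m''"
proof -
  obtain t t' where "t \<le> T" "exec c t m m'" "t' \<le> T'" "exec (Loop i S c) t' m' m''"
    using assms by (auto simp: runs_def)
  then show ?thesis
    using assms(1,4) by (auto simp: runs_def intro!: exI[of _ "Suc (t + t')"] exec.LoopT)
qed

text \<open>
  A loop whose successive memories are \<open>f 0, f 1, \<dots>, f j\<close>.
\<close>

lemma runs_Loop_iterate:
  assumes "\<And>k. k < j \<Longrightarrow> read_tape (f k i) \<in> S" "\<And>k. k < j \<Longrightarrow> runs c T (f k) (f (Suc k))"
    and "read_tape (f j i) \<notin> S"
  shows "runs (Loop i S c) (j * Suc T + 1) (f 0) (f j)"
  using assms
proof (induction j arbitrary: f)
  case 0
  then show ?case by (simp add: runs_LoopF)
next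
  case (Suc j)
  have "runs (Loop i S c) (j * Suc T + 1) (f (Suc 0)) (f (Suc j))"
    using Suc.prems by (intro Suc.IH[of "\<lambda>k. f (Suc k)"]) auto
  with Suc.prems(1)[of 0] Suc.prems(2)[of 0] show ?case by (auto elim: runs_LoopT)
qed

lemma runs_Skip [simp]: "runs Skip T m m' \<longleftrightarrow> m' = m"
  by (auto simp: runs_def elim: exec_SkipE intro: exec.Skip)

lemma runs_Write [simp]: "runs (Write i s) T m m' \<longleftrightarrow> 0 < T \<and> m' = m(i := put s (m i))"
proof
  assume "0 < T \<and> m' = m(i := put s (m i))"
  then show "runs (Write i s) T m m'"
    by (auto simp: runs_def intro!: exI[of _ 1] exec.Write)
qed (auto simp: runs_def elim: exec_WriteE)

lemma runs_Move [simp]: "runs (Move i d) T m m' \<longleftrightarrow> 0 < T \<and> m' = m(i := shift d (m i))"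
proof
  assume "0 < T \<and> m' = m(i := shift d (m i))"
  then show "runs (Move i d) T m m'"
    by (auto simp: runs_def intro!: exI[of _ 1] exec.Move)
qed (auto simp: runs_def elim: exec_MoveE)

lemma runs_Cond [simp]:
  "runs (Cond i S c c') T m m' \<longleftrightarrow>
     0 < T \<and> (if read_tape (m i) \<in> S then runs c (T - 1) m m' else runs c' (T - 1) m m')"
proof
  assume *: "0 < T \<and> (if read_tape (m i) \<in> S then runs c (T - 1) m m' else runs c' (T - 1) m m')"
  then show "runs (Cond i S c c') T m m'"
  proof (cases "read_tape (m i) \<in> S")
    case True
    with * obtain t where "t \<le> T - 1" "exec c t m m'" by (auto simp: runs_def)
    then show ?thesis
      using * True by (auto simp: runs_def intro!: exI[of _ "Suc t"] exec.CondT)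
  next
    case False
    with * obtain t where "t \<le> T - 1" "exec c' t m m'" by (auto simp: runs_def)
    then show ?thesis
      using * False by (auto simp: runs_def intro!: exI[of _ "Suc t"] exec.CondF)
  qed
next
  assume "runs (Cond i S c c') T m m'"
  then obtain t where t: "t \<le> T" "exec (Cond i S c c') t m m'" by (auto simp: runs_def)
  from t(2) show "0 < T \<and> (if read_tape (m i) \<in> S then runs c (T - 1) m m' else runs c' (T - 1) m m')"
  proof (rule exec_CondE)
    fix t' assume "t = Suc t'" "read_tape (m i) \<in> S" "exec c t' m m'"
    then show ?thesis using t(1) by (auto simp: runs_def intro!: exI[of _ t'])
  next
    fix t' assume "t = Suc t'" "read_tape (m i) \<notin> S" "exec c' t' m m'"
    then show ?thesis using t(1) by (auto simp: runs_def intro!: exI[of _ t'])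
  qed
qed

lemma runs_Seq_iff: "runs (c ;; c') T m m' \<longleftrightarrow>
    (\<exists>t m1. t \<le> T \<and> exec c t m m1 \<and> runs c' (T - t) m1 m')"
proof
  assume "runs (c ;; c') T m m'"
  then show "\<exists>t m1. t \<le> T \<and> exec c t m m1 \<and> runs c' (T - t) m1 m'"
    unfolding runs_def by (elim exE conjE exec_SeqE) (metis diff_le_mono le_add1 diff_add_inverse order_trans)
next
  assume "\<exists>t m1. t \<le> T \<and> exec c t m m1 \<and> runs c' (T - t) m1 m'"
  then obtain t m1 t' where "t \<le> T" "exec c t m m1" "t' \<le> T - t" "exec c' t' m1 m'"
    by (auto simp: runs_def)
  then show "runs (c ;; c') T m m'"
    by (auto simp: runs_def intro!: exI[of _ "t + t'"] exec.Seq)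
qed

lemma runs_Skip_Seq [simp]: "runs (Skip ;; c) T m m' \<longleftrightarrow> runs c T m m'"
  unfolding runs_Seq_iff by (auto elim!: exec_SkipE intro!: exI[of _ 0] exI[of _ m] exec.Skip)

lemma runs_Write_Seq [simp]:
  "runs (Write i s ;; c) T m m' \<longleftrightarrow> 0 < T \<and> runs c (T - 1) (m(i := put s (m i))) m'"
  unfolding runs_Seq_iff by (auto elim!: exec_WriteE intro!: exI[of _ 1] exec.Write)

lemma runs_Move_Seq [simp]:
  "runs (Move i d ;; c) T m m' \<longleftrightarrow> 0 < T \<and> runs c (T - 1) (m(i := shift d (m i))) m'"
  unfolding runs_Seq_iff by (auto elim!: exec_MoveE intro!: exI[of _ 1] exec.Move)

lemma runs_Seq_Seq [simp]: "runs ((c ;; c') ;; c'') T m m' \<longleftrightarrow> runs (c ;; c' ;; c'') T m m'"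
proof -
  have "exec ((c ;; c') ;; c'') t m m' \<longleftrightarrow> exec (c ;; c' ;; c'') t m m'" for t
    by (auto elim!: exec_SeqE intro: exec.Seq simp: add.assoc) (metis exec.Seq add.assoc)+
  then show ?thesis by (simp add: runs_def)
qed

lemma runs_Cond_Seq [simp]:
  "runs (Cond i S c c' ;; c'') T m m' \<longleftrightarrow> runs (Cond i S (c ;; c'') (c' ;; c'')) T m m'"
proof -
  have "exec (Cond i S c c' ;; c'') t m m' \<longleftrightarrow> exec (Cond i S (c ;; c'') (c' ;; c'')) t m m'" for t
  proof
    assume "exec (Cond i S c c' ;; c'') t m m'"
    then show "exec (Cond i S (c ;; c'') (c' ;; c'')) t m m'"
      by (elim exec_SeqE exec_CondE) (use exec.Seq exec.CondT exec.CondF in fastforce)+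
  next
    assume "exec (Cond i S (c ;; c'') (c' ;; c'')) t m m'"
    then show "exec (Cond i S c c' ;; c'') t m m'"
      by (auto elim!: exec_SeqE exec_CondE) (metis exec.Seq exec.CondT exec.CondF add_Suc)+
  qed
  then show ?thesis by (simp add: runs_def)
qed

section \<open>Representation of data on tapes\<close>

text \<open>
  The input tape with word \<open>xs @ ys\<close> and its head on the first letter of \<open>ys\<close>.
\<close>

definition input_at :: "bool list \<Rightarrow> bool list \<Rightarrow> tape" where
  "input_at xs ys = (int (length xs), snd (input_tape (xs @ ys)))"

text \<open>
  A tape with head on cell \<open>p\<close> that stores the symbol \<open>st j\<close> of vertex \<open>j\<close> in cell \<open>Suc j\<close>. Cell \<open>0\<close>
  is blank, so the head can find its way back to it.
\<close>

definition marks :: "nat \<Rightarrow> (nat \<Rightarrow> nat) \<Rightarrow> tape" where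
  "marks p st = (int p, \<lambda>z. if z > 0 then st (nat (z - 1)) else 0)"

text \<open>
  A truth value, as a tape whose head never moves.
\<close>

definition bit :: "bool \<Rightarrow> tape" where
  "bit x = (0, (\<lambda>_. 0)(0 := of_bool x))"

lemma read_input_at [simp]:
  "read_tape (input_at xs []) = 0"
  "read_tape (input_at xs (y # ys)) = (if y then 2 else 1)"
  by (auto simp: read_tape_def input_at_def input_tape_def nth_append)

lemma shift_input_at [simp]:
  "shift MoveRight (input_at xs (y # ys)) = input_at (xs @ [y]) ys"
  "shift MoveLeft (input_at (xs @ [y]) ys) = input_at xs (y # ys)"
  by (auto simp: shift_def input_at_def)

lemma input_tape_eq: "input_tape w = input_at [] w"
  by (simp add: input_at_def input_tape_def)

lemma read_marks [simp]: "read_tape (marks 0 st) = 0" "read_tape (marks (Suc j) st) = st j"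
  by (auto simp: read_tape_def marks_def)

lemma put_marks [simp]: "put x (marks (Suc j) st) = marks (Suc j) (st(j := x))"
  by (auto simp: put_def marks_def fun_eq_iff)

lemma shift_marks [simp]:
  "shift MoveRight (marks j st) = marks (Suc j) st"
  "shift MoveLeft (marks (Suc j) st) = marks j st"
  by (auto simp: shift_def marks_def)

lemma marks_blank: "blank_tape = marks 0 (\<lambda>_. 0)"
  by (auto simp: blank_tape_def marks_def)

lemma read_bit [simp]: "read_tape (bit x) = of_bool x"
  by (simp add: read_tape_def bit_def)

lemma put_bit [simp]: "put 0 (bit x) = bit False" "put (Suc 0) (bit x) = bit True"
  by (auto simp: put_def bit_def)

lemma bit_blank: "blank_tape = bit False"
  by (auto simp: blank_tape_def bit_def)

text \<open>
  The seven tapes of the decision procedure, numbered from \<open>0\<close> on: the input \<open>x\<close>, the marks \<open>t\<close> of the vertices, and a tape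
  \<open>s\<close> whose head points at the start vertex; then the flags \<open>f\<close> (this start vertex has failed),
  \<open>b\<close> (the current pass has found the next vertex), \<open>d\<close> (the tail of the arc being read is the current
  vertex) and \<open>a\<close> (some start vertex has succeeded).
\<close>

definition memory :: "tape \<Rightarrow> tape \<Rightarrow> tape \<Rightarrow> bool \<Rightarrow> bool \<Rightarrow> bool \<Rightarrow> bool \<Rightarrow> memory" where
  "memory x t s f b d a = (\<lambda>_. blank_tape)
     (0 := x, 1 := t, 2 := s, 3 := bit f, 4 := bit b, 5 := bit d, 6 := bit a)"

lemma memory_read [simp]:
  "memory x t s f b d a 0 = x"
  "memory x t s f b d a (Suc 0) = t"
  "memory x t s f b d a 2 = s"
  "memory x t s f b d a 3 = bit f"
  "memory x t s f b d a 4 = bit b"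
  "memory x t s f b d a 5 = bit d"
  "memory x t s f b d a 6 = bit a"
  by (simp_all add: memory_def)

lemma memory_update [simp]:
  "(memory x t s f b d a)(0 := x') = memory x' t s f b d a"
  "(memory x t s f b d a)(Suc 0 := t') = memory x t' s f b d a"
  "(memory x t s f b d a)(2 := s') = memory x t s' f b d a"
  "(memory x t s f b d a)(3 := bit f') = memory x t s f' b d a"
  "(memory x t s f b d a)(4 := bit b') = memory x t s f b' d a"
  "(memory x t s f b d a)(5 := bit d') = memory x t s f b d' a"
  "(memory x t s f b d a)(6 := bit a') = memory x t s f b d a'"
  by (auto simp: memory_def fun_eq_iff)

text \<open>
  A marking of the vertices below \<open>n\<close>: exactly these have a nonblank symbol. The symbols are \<open>1\<close> for
  visited, \<open>2\<close> for current, \<open>3\<close> for unvisited, and \<open>4\<close> for the candidate that a pass has found to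
  become current next.
\<close>

definition marking :: "nat \<Rightarrow> (nat \<Rightarrow> nat) \<Rightarrow> bool" where
  "marking n st \<longleftrightarrow> (\<forall>j. st j = 0 \<longleftrightarrow> n \<le> j)"

lemma marking_eq_0: "marking n st \<Longrightarrow> st j = 0 \<longleftrightarrow> n \<le> j"
  by (simp add: marking_def)

lemma marking_min: "marking n st \<Longrightarrow> st (min j n) = st j"
  using marking_eq_0[of n st j] marking_eq_0[of n st n] by (cases "j \<le> n") auto

lemma marking_update: "marking n st \<Longrightarrow> j < n \<Longrightarrow> 0 < x \<Longrightarrow> marking n (st(j := x))"
  by (auto simp: marking_def)

section \<open>The decision procedure\<close>

definition rewind_marks :: com where
  "rewind_marks = Loop 1 (- {0}) (Move 1 MoveLeft)"

text \<open>
  Reads a block of ones and moves the head on the marks by as many cells, so that it ends on the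
  symbol of the vertex read. The head stops at the first blank, where it ends for numbers that
  are no vertices.
\<close>

definition load :: com where
  "load = Move 1 MoveRight ;; Loop 0 {2} (Move 0 MoveRight ;; Cond 1 {0} Skip (Move 1 MoveRight))"

text \<open>
  Returns to cell \<open>0\<close> of the marks and skips the zero that ends the block; if the word ends without
  it, the fail flag is set.
\<close>

definition finish :: com where
  "finish = Move 1 MoveLeft ;; rewind_marks ;; Cond 0 {1} (Move 0 MoveRight) (Write 3 1)"

text \<open>
  The marks are blank if the number read is not a vertex.
\<close>

definition check_tail :: com where
  "check_tail = Cond 1 {0} (Write 3 1) Skip ;; Cond 1 {2} (Write 5 1) Skip"

text \<open>
  If the tail is the current vertex, then the head must be neither the current vertex (a loop) nor
  the candidate (a parallel arc). An unvisited head becomes the candidate, but there must be none yet.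
\<close>

definition check_head :: com where
  "check_head =
     Cond 1 {0} (Write 3 1)
       (Cond 5 {1}
         (Cond 1 {2, 4} (Write 3 1)
           (Cond 1 {3} (Cond 4 {1} (Write 3 1) (Write 1 4 ;; Write 4 1)) Skip))
         Skip) ;;
     Write 5 0"

definition scan_arc :: com where
  "scan_arc = load ;; check_tail ;; finish ;; load ;; check_head ;; finish"

definition scan :: com where
  "scan = Loop 0 {1, 2} scan_arc"

text \<open>
  Runs \<open>c\<close> once on the symbol of each vertex.
\<close>

definition sweep :: "com \<Rightarrow> com" where
  "sweep c = Move 1 MoveRight ;; Loop 1 (- {0}) (c ;; Move 1 MoveRight) ;; Move 1 MoveLeft ;; rewind_marks"

text \<open>
  Moves the input head to the first arc.
\<close>

definition restart :: com where
  "restart = Move 0 MoveLeft ;; Loop 0 {1, 2} (Move 0 MoveLeft) ;; Move 0 MoveRight ;;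
     Loop 0 {2} (Move 0 MoveRight) ;; Move 0 MoveRight"

text \<open>
  The current vertex becomes visited, and the candidate becomes current.
\<close>

definition advance :: com where
  "advance = sweep (Cond 1 {2} (Write 1 1) (Cond 1 {4} (Write 1 2) Skip))"

definition pass :: com where
  "pass = Write 4 0 ;; restart ;; scan ;; advance"

text \<open>
  Marks the start vertex as current. Moving the heads of tapes \<open>1\<close> and \<open>2\<close> in opposite directions
  transfers the head position from one to the other and back.
\<close>

definition place :: com where
  "place = Loop 2 {1} (Move 2 MoveLeft ;; Move 1 MoveRight) ;; Write 1 2 ;;
     Loop 1 (- {0}) (Move 1 MoveLeft ;; Move 2 MoveRight)"

text \<open>
  Builds the greedy path from one start vertex and sets the answer flag if nothing failed and no
  vertex is left unvisited.
\<close>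

definition try_start :: com where
  "try_start = sweep (Write 1 3) ;; place ;; Write 3 0 ;; Write 4 1 ;; Loop 4 {1} pass ;;
     sweep (Cond 1 {3} (Write 3 1) Skip) ;; Cond 3 {0} (Write 6 1) Skip"

text \<open>
  The first loop writes \<open>n\<close> nonblank symbols on tapes \<open>1\<close> and \<open>2\<close>. Start vertices are then tried in
  decreasing order, as the head of tape \<open>2\<close> moves left. If the first block has no final zero, the
  answer flag stays unset.
\<close>

definition decide :: com where
  "decide =
     Loop 0 {2} (Move 0 MoveRight ;; Move 1 MoveRight ;; Write 1 3 ;; Move 2 MoveRight ;; Write 2 1) ;;
     rewind_marks ;;
     Cond 0 {1} (Loop 2 {1} (try_start ;; Move 2 MoveLeft)) Skip"

lemma bounded_decide: "bounded_com 7 5 decide"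
  by (simp add: decide_def try_start_def place_def pass_def advance_def restart_def sweep_def scan_def
      scan_arc_def check_head_def check_tail_def finish_def load_def rewind_marks_def)

section \<open>Reading the arcs\<close>

lemma runs_rewind_marks:
  assumes "marking n st" "j \<le> n"
  shows "runs rewind_marks (2 * j + 1) (memory x (marks j st) s f b d a) (memory x (marks 0 st) s f b d a)"
  using assms(2)
proof (induction j)
  case 0
  then show ?case unfolding rewind_marks_def by (intro runs_LoopF) auto
next
  case (Suc j)
  have "read_tape (memory x (marks (Suc j) st) s f b d a 1) \<in> - {0}"
    using assms(1) Suc.prems by (simp add: marking_eq_0)
  moreover have "runs (Move 1 MoveLeft) 1 (memory x (marks (Suc j) st) s f b d a)
      (memory x (marks j st) s f b d a)" by simp
  moreover have "runs rewind_marks (2 * j + 1) (memory x (marks j st) s f b d a)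
      (memory x (marks 0 st) s f b d a)" using Suc by simp
  ultimately show ?case unfolding rewind_marks_def by (rule runs_LoopT) simp
qed

lemma runs_load:
  assumes "marking n st" "r = [] \<or> \<not> hd r"
  shows "runs load (4 * u + 2) (memory (input_at w (replicate u True @ r)) (marks 0 st) s f b d a)
    (memory (input_at (w @ replicate u True) r) (marks (Suc (min u n)) st) s f b d a)"
proof -
  let ?L = "Loop 0 {2} (Move 0 MoveRight ;; Cond 1 {0} Skip (Move 1 MoveRight))"
  have *: "runs ?L (4 * u + 1)
      (memory (input_at w (replicate u True @ r)) (marks (Suc j) st) s f b d a)
      (memory (input_at (w @ replicate u True) r) (marks (Suc (min (j + u) n)) st) s f b d a)"
    if "j \<le> n" for j w
    using that
  proof (induction u arbitrary: j w)
    case 0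
    then show ?case using assms(2) by (cases r) (auto intro!: runs_LoopF simp: min_def)
  next
    case (Suc u)
    let ?j = "if j = n then j else Suc j"
    let ?m = "memory (input_at (w @ [True]) (replicate u True @ r)) (marks (Suc ?j) st) s f b d a"
    have 2: "runs ?L (4 * u + 1) ?m
        (memory (input_at ((w @ [True]) @ replicate u True) r) (marks (Suc (min (?j + u) n)) st) s f b d a)"
      using Suc.prems by (intro Suc.IH) auto
    have eq: "min (?j + u) n = min (j + Suc u) n" using Suc.prems by auto
    have 1: "runs (Move 0 MoveRight ;; Cond 1 {0} Skip (Move 1 MoveRight)) 3
        (memory (input_at w (replicate (Suc u) True @ r)) (marks (Suc j) st) s f b d a) ?m"
      using Suc.prems assms(1) by (simp add: marking_eq_0)
    show ?case using 2 unfolding eq by (intro runs_LoopT[OF _ 1]) auto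
  qed
  show ?thesis
    unfolding load_def using *[of 0 w] by simp
qed

lemma runs_finish:
  assumes "marking n st" "r = [] \<or> \<not> hd r" "j \<le> n"
  shows "runs finish (2 * j + 4) (memory (input_at w r) (marks (Suc j) st) s f b d a)
    (memory (input_at (w @ take 1 r) (drop 1 r)) (marks 0 st) s (f \<or> r = []) b d a)"
proof -
  have "runs (rewind_marks ;; Cond 0 {1} (Move 0 MoveRight) (Write 3 1)) (2 * j + 1 + 2)
     (memory (input_at w r) (marks j st) s f b d a)
     (memory (input_at (w @ take 1 r) (drop 1 r)) (marks 0 st) s (f \<or> r = []) b d a)"
    by (rule runs_Seq[OF runs_rewind_marks[OF assms(1,3)], where T' = 2])
      (use assms(2) in \<open>cases r; auto\<close>)+
  moreover have "2 * j + 1 + 2 = 2 * j + 4 - 1" by simp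
  ultimately have "runs (rewind_marks ;; Cond 0 {1} (Move 0 MoveRight) (Write 3 1)) (2 * j + 4 - 1)
     (memory (input_at w r) (marks j st) s f b d a)
     (memory (input_at (w @ take 1 r) (drop 1 r)) (marks 0 st) s (f \<or> r = []) b d a)" by metis
  then show ?thesis unfolding finish_def by simp
qed

text \<open>
  The effect of one arc \<open>e\<close> on the marks \<open>st\<close>, the fail flag \<open>f\<close> and the flag \<open>b\<close>. An arc hits if its
  head becomes the candidate.
\<close>

definition arc_fails :: "nat \<times> nat \<Rightarrow> (nat \<Rightarrow> nat) \<Rightarrow> bool \<Rightarrow> bool" where
  "arc_fails e st b \<longleftrightarrow> st (fst e) = 0 \<or> st (snd e) = 0 \<or>
     st (fst e) = 2 \<and> (st (snd e) \<in> {2, 4} \<or> st (snd e) = 3 \<and> b)"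

definition arc_hits :: "nat \<times> nat \<Rightarrow> (nat \<Rightarrow> nat) \<Rightarrow> bool \<Rightarrow> bool" where
  "arc_hits e st b \<longleftrightarrow> st (fst e) = 2 \<and> st (snd e) = 3 \<and> \<not> b"

definition arc_step :: "nat \<times> nat \<Rightarrow> (nat \<Rightarrow> nat) \<times> bool \<times> bool \<Rightarrow> (nat \<Rightarrow> nat) \<times> bool \<times> bool" where
  "arc_step e = (\<lambda>(st, f, b).
     (if arc_hits e st b then st(snd e := 4) else st, f \<or> arc_fails e st b, b \<or> arc_hits e st b))"

text \<open>
  Missing blocks and missing final zeros are included: \<open>r\<close> and \<open>r'\<close> are what follows the ones of the
  two blocks, and a word that ends too early counts as one that continues with empty blocks.
\<close>

lemma runs_scan_arc:
  assumes st: "marking n st" and r: "r = [] \<or> \<not> hd r" "r' = [] \<or> \<not> hd r'"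
    and "drop 1 r = replicate v True @ r'"
    and step: "arc_step (u, v) (st, f, b) = (st', f', b')"
  shows "runs scan_arc (6 * u + 6 * v + 30) (memory (input_at w (replicate u True @ r)) (marks 0 st) s f b False a)
    (memory (input_at (w @ replicate u True @ take 1 r @ replicate v True @ take 1 r') (drop 1 r'))
       (marks 0 st') s (f' \<or> r = [] \<or> r' = []) b' False a)"
proof -
  let ?f1 = "f \<or> st u = 0" and ?d = "st u = 2"
  let ?w1 = "w @ replicate u True"
  let ?w2 = "?w1 @ take 1 r"
  let ?w3 = "?w2 @ replicate v True"
  let ?f2 = "?f1 \<or> r = []"
  have st': "st' = (if arc_hits (u, v) st b then st(v := 4) else st)"
    "f' = (f \<or> arc_fails (u, v) st b)" "b' = (b \<or> arc_hits (u, v) st b)"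
    using step by (auto simp: arc_step_def)
  have v: "v < n" if "arc_hits (u, v) st b"
    using that st marking_eq_0[of n st v] by (auto simp: arc_hits_def)
  have m': "marking n st'"
    using st v by (auto simp: st' intro!: marking_update)
  let ?M = "\<lambda>x t f b d. memory x t s f b d a"
  have 1: "runs load (4 * u + 2) (?M (input_at w (replicate u True @ r)) (marks 0 st) f b False)
      (?M (input_at ?w1 r) (marks (Suc (min u n)) st) f b False)"
    by (rule runs_load[OF st r(1)])
  have 2: "runs check_tail 4 (?M (input_at ?w1 r) (marks (Suc (min u n)) st) f b False)
      (?M (input_at ?w1 r) (marks (Suc (min u n)) st) ?f1 b ?d)"
    by (simp add: check_tail_def marking_min[OF st])
  have 3: "runs finish (2 * min u n + 4) (?M (input_at ?w1 r) (marks (Suc (min u n)) st) ?f1 b ?d)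
      (?M (input_at ?w2 (replicate v True @ r')) (marks 0 st) ?f2 b ?d)"
    unfolding assms(4)[symmetric] by (rule runs_finish[OF st r(1)]) simp
  have 4: "runs load (4 * v + 2) (?M (input_at ?w2 (replicate v True @ r')) (marks 0 st) ?f2 b ?d)
      (?M (input_at ?w3 r') (marks (Suc (min v n)) st) ?f2 b ?d)"
    by (rule runs_load[OF st r(2)])
  have 5: "runs check_head 8 (?M (input_at ?w3 r') (marks (Suc (min v n)) st) ?f2 b ?d)
      (?M (input_at ?w3 r') (marks (Suc (min v n)) st') (f' \<or> r = []) b' False)"
    using v by (auto simp: check_head_def marking_min[OF st] st' arc_fails_def arc_hits_def)
  have 6: "runs finish (2 * min v n + 4)
      (?M (input_at ?w3 r') (marks (Suc (min v n)) st') (f' \<or> r = []) b' False)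
      (?M (input_at (?w3 @ take 1 r') (drop 1 r')) (marks 0 st') ((f' \<or> r = []) \<or> r' = []) b' False)"
    by (rule runs_finish[OF m' r(2)]) simp
  note * = runs_Seq[OF 1 runs_Seq[OF 2 runs_Seq[OF 3 runs_Seq[OF 4 runs_Seq[OF 5 6 order_refl]
    order_refl] order_refl] order_refl], folded scan_arc_def]
  show ?thesis
    using *[of "6 * u + 6 * v + 30"] by (simp add: disj_assoc)
qed

lemma read_encode_nat [simp]:
  "read_tape (input_at xs (encode_nat u @ ys)) = (if u = 0 then 1 else 2)"
  by (cases u) (auto simp: encode_nat_def)

text \<open>
  \<open>reads w es m\<close>: a machine that reads pairs of blocks from \<open>w\<close> sees the arcs \<open>es\<close>, and \<open>m\<close> tells
  whether \<open>w\<close> is malformed, that is, whether the last pair is incomplete.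
\<close>

inductive reads :: "bool list \<Rightarrow> (nat \<times> nat) list \<Rightarrow> bool \<Rightarrow> bool" where
  reads_Nil: "reads [] [] False"
| reads_Cons: "reads w es m \<Longrightarrow> reads (encode_nat u @ encode_nat v @ w) ((u, v) # es) m"
| reads_tail: "0 < u \<Longrightarrow> reads (replicate u True) [(u, 0)] True"
| reads_head: "reads (encode_nat u @ replicate v True) [(u, v)] True"

text \<open>
  The part of \<open>encode_digraph\<close> that follows the number of vertices.
\<close>

abbreviation encode_arcs :: "(nat \<times> nat) list \<Rightarrow> bool list" where
  "encode_arcs es \<equiv> concat (map (\<lambda>(u, v). encode_nat u @ encode_nat v) es)"

lemma split_block: "\<exists>u r. w = replicate u True @ r \<and> (r = [] \<or> (\<exists>r'. r = False # r'))"
proof (induction w)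
  case (Cons x w)
  then obtain u r where *: "w = replicate u True @ r" "r = [] \<or> (\<exists>r'. r = False # r')" by auto
  show ?case
  proof (cases x)
    case True
    then show ?thesis using * by (intro exI[of _ "Suc u"] exI[of _ r]) auto
  next
    case False
    then show ?thesis by (intro exI[of _ 0] exI[of _ "x # w"]) auto
  qed
qed auto

lemma reads_exists: "\<exists>es m. reads w es m"
proof (induction w rule: length_induct)
  case (1 w)
  obtain u r where w: "w = replicate u True @ r" "r = [] \<or> (\<exists>r'. r = False # r')"
    using split_block by blast
  show ?case
  proof (cases r)
    case Nil
    then show ?thesis using w reads_Nil reads_tail[of u] by (cases u) auto
  next
    case (Cons x r1)
    obtain v r2 where r1: "r1 = replicate v True @ r2" "r2 = [] \<or> (\<exists>r'. r2 = False # r')"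
      using split_block by blast
    have w': "w = encode_nat u @ r1" using w Cons by (auto simp: encode_nat_def)
    show ?thesis
    proof (cases r2)
      case Nil
      then show ?thesis using w' r1 reads_head by auto
    next
      case (Cons y r3)
      then have eq: "w = encode_nat u @ encode_nat v @ r3"
        using w' r1 by (auto simp: encode_nat_def)
      then have "length r3 < length w" by (simp add: encode_nat_def)
      with 1 obtain es m where "reads r3 es m" by blast
      then show ?thesis unfolding eq by (blast intro: reads_Cons)
    qed
  qed
qed

lemma reads_encodes: "reads w es m \<Longrightarrow> \<not> m \<Longrightarrow> w = encode_arcs es"
  by (induction rule: reads.induct) auto

lemma replicate_True_ne: "replicate u True \<noteq> replicate v True @ False # w"
proof
  assume "replicate u True = replicate v True @ False # w"
  then have "False \<in> set (replicate u True)" by (simp del: set_replicate_conv_if)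
  then show False by simp
qed

lemma reads_malformed: "reads w es m \<Longrightarrow> m \<Longrightarrow> w \<noteq> encode_arcs es'"
proof (induction arbitrary: es' rule: reads.induct)
  case (reads_Cons w es m u v)
  then show ?case
    by (cases es') (auto simp: encode_nat_def replicate_False_append_eq)
next
  case (reads_tail u)
  then show ?case by (cases es') (auto simp: encode_nat_def replicate_True_ne)
next
  case (reads_head u v)
  then show ?case
    by (cases es') (auto simp: encode_nat_def replicate_False_append_eq replicate_True_ne)
qed simp

lemma arc_step_marking:
  "marking n st \<Longrightarrow> arc_step e (st, f, b) = (st', f', b') \<Longrightarrow> marking n st'"
  unfolding arc_step_def arc_hits_def
  using marking_eq_0[of n st "snd e"] marking_update[of n st "snd e" 4] by (auto split: if_splits)

lemma length_encode_nat: "length (encode_nat u) = Suc u"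
  by (simp add: encode_nat_def)

text \<open>
  An arc with ends \<open>u\<close> and \<open>v\<close> costs at most \<open>6 * u + 6 * v + 31\<close> steps and takes up at least one
  letter and at least \<open>u + v\<close> letters, so \<open>40\<close> steps for each letter suffice.
\<close>

lemma runs_scan:
  assumes "reads w es m" "marking n st" "fold arc_step es (st, f, b) = (st', f', b')"
  shows "runs scan (40 * length w + 1) (memory (input_at w0 w) (marks 0 st) s f b False a)
    (memory (input_at (w0 @ w) []) (marks 0 st') s (f' \<or> m) b' False a)"
  using assms
proof (induction arbitrary: w0 st f b rule: reads.induct)
  case reads_Nil
  then show ?case by (auto simp: scan_def intro!: runs_LoopF)
next
  case (reads_Cons w es m u v)
  obtain st1 f1 b1 where step: "arc_step (u, v) (st, f, b) = (st1, f1, b1)"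
    by (metis prod_cases3)
  have 1: "runs scan_arc (6 * u + 6 * v + 30)
     (memory (input_at w0 (encode_nat u @ encode_nat v @ w)) (marks 0 st) s f b False a)
     (memory (input_at (w0 @ encode_nat u @ encode_nat v) w) (marks 0 st1) s f1 b1 False a)"
    using runs_scan_arc[OF reads_Cons.prems(1) _ _ _ step, of "False # encode_nat v @ w" "False # w" w0 s a]
    by (simp add: encode_nat_def)
  have 2: "runs scan (40 * length w + 1)
     (memory (input_at (w0 @ encode_nat u @ encode_nat v) w) (marks 0 st1) s f1 b1 False a)
     (memory (input_at ((w0 @ encode_nat u @ encode_nat v) @ w) []) (marks 0 st') s (f' \<or> m) b' False a)"
    using reads_Cons step by (intro reads_Cons.IH) (auto intro: arc_step_marking)
  show ?case
    unfolding scan_def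
    using runs_LoopT[OF _ 1 2[unfolded scan_def]] by (simp add: length_encode_nat)
next
  case (reads_tail u)
  then have 1: "runs scan_arc (6 * u + 30)
     (memory (input_at w0 (replicate u True)) (marks 0 st) s f b False a)
     (memory (input_at (w0 @ replicate u True) []) (marks 0 st') s True b' False a)"
    using runs_scan_arc[of n st "[]" "[]" 0 u f b st' f' b' w0 s a] by simp
  show ?case
    unfolding scan_def
    by (rule runs_LoopT[OF _ 1, where T' = 1])
      (use reads_tail in \<open>auto simp: gr0_conv_Suc intro!: runs_LoopF\<close>)
next
  case (reads_head u v)
  then have 1: "runs scan_arc (6 * u + 6 * v + 30)
     (memory (input_at w0 (encode_nat u @ replicate v True)) (marks 0 st) s f b False a)
     (memory (input_at (w0 @ encode_nat u @ replicate v True) []) (marks 0 st') s True b' False a)"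
    using runs_scan_arc[of n st "False # replicate v True" "[]" v u f b st' f' b' w0 s a]
    by (simp add: encode_nat_def)
  show ?case
    unfolding scan_def
    by (rule runs_LoopT[OF _ 1, where T' = 1]) (auto simp: length_encode_nat intro!: runs_LoopF)
qed


section \<open>Sweeps over the vertices and return to the first arc\<close>

text \<open>
  The fail flag may change during a sweep: \<open>f i\<close> is its value after \<open>i\<close> vertices.
\<close>

lemma runs_sweep:
  assumes st: "marking n st" and st': "marking n st'"
    and step: "\<And>i. i < n \<Longrightarrow> runs c T
      (memory x (marks (Suc i) (\<lambda>j. if j < i then st' j else st j)) s (f i) b d a)
      (memory x (marks (Suc i) (\<lambda>j. if j < Suc i then st' j else st j)) s (f (Suc i)) b d a)"
  shows "runs (sweep c) (n * (T + 4) + 4) (memory x (marks 0 st) s (f 0) b d a)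
    (memory x (marks 0 st') s (f n) b d a)"
proof -
  let ?mix = "\<lambda>k j. if j < k then st' j else st j"
  let ?F = "\<lambda>k. memory x (marks (Suc k) (?mix k)) s (f k) b d a"
  have "st j = st' j" if "n \<le> j" for j
    using that marking_eq_0[OF st, of j] marking_eq_0[OF st', of j] by simp
  then have mix: "?mix n = st'" by (auto simp: fun_eq_iff)
  have read: "read_tape (?F k 1) \<noteq> 0 \<longleftrightarrow> k < n" if "k \<le> n" for k
    using that st by (auto simp: marking_eq_0)
  have "runs (c ;; Move 1 MoveRight) (Suc T) (?F k) (?F (Suc k))" if "k < n" for k
    by (rule runs_Seq[OF step[OF that], where T' = 1]) auto
  then have 1: "runs (Loop 1 (- {0}) (c ;; Move 1 MoveRight)) (n * Suc (Suc T) + 1) (?F 0) (?F n)"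
    by (intro runs_Loop_iterate) (use read in \<open>auto simp del: memory_read\<close>)
  have 2: "runs (Move 1 MoveLeft ;; rewind_marks) (2 * n + 2) (?F n) (memory x (marks 0 st') s (f n) b d a)"
    unfolding mix using runs_rewind_marks[OF st' order_refl] by simp
  have "runs (Loop 1 (- {0}) (c ;; Move 1 MoveRight) ;; Move 1 MoveLeft ;; rewind_marks)
    (n * (T + 4) + 4 - 1) (?F 0) (memory x (marks 0 st') s (f n) b d a)"
    by (rule runs_Seq[OF 1 2]) (simp add: algebra_simps)
  then show ?thesis by (simp add: sweep_def)
qed

definition advance_symbol :: "nat \<Rightarrow> nat" where
  "advance_symbol x = (if x = 2 then 1 else if x = 4 then 2 else x)"

lemma advance_symbol_eq_0: "advance_symbol x = 0 \<longleftrightarrow> x = 0"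
  by (simp add: advance_symbol_def)

lemma runs_advance:
  assumes "marking n st"
  shows "runs advance (7 * n + 4) (memory x (marks 0 st) s f b d a)
    (memory x (marks 0 (advance_symbol \<circ> st)) s f b d a)"
proof -
  have eq: "(\<lambda>j. if j < Suc i then (advance_symbol \<circ> st) j else st j) =
      (\<lambda>j. if j < i then (advance_symbol \<circ> st) j else st j)(i := advance_symbol (st i))" for i
    by (auto simp: fun_eq_iff less_Suc_eq)
  have [simp]: "g(i := g i) = g" for g :: "nat \<Rightarrow> nat" and i by simp
  have *: "runs (Cond 1 {2} (Write 1 1) (Cond 1 {4} (Write 1 2) Skip)) 3
     (memory x (marks (Suc i) g) s f b d a)
     (memory x (marks (Suc i) (g(i := advance_symbol (g i)))) s f b d a)" for i g
    by (simp add: advance_symbol_def)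
  have "runs advance (n * (3 + 4) + 4) (memory x (marks 0 st) s f b d a)
    (memory x (marks 0 (advance_symbol \<circ> st)) s f b d a)"
    unfolding advance_def
  proof (rule runs_sweep[OF assms, where f = "\<lambda>_. f"])
    show "marking n (advance_symbol \<circ> st)"
      using assms by (simp add: marking_def advance_symbol_eq_0)
  next
    fix i
    show "runs (Cond 1 {2} (Write 1 1) (Cond 1 {4} (Write 1 2) Skip)) 3
      (memory x (marks (Suc i) (\<lambda>j. if j < i then (advance_symbol \<circ> st) j else st j)) s f b d a)
      (memory x (marks (Suc i) (\<lambda>j. if j < Suc i then (advance_symbol \<circ> st) j else st j)) s f b d a)"
      unfolding eq using *[of i "\<lambda>j. if j < i then (advance_symbol \<circ> st) j else st j"] by simp
  qed
  then show ?thesis by (simp add: algebra_simps)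
qed

lemma runs_rewind_input:
  "ys \<noteq> [] \<Longrightarrow> runs (Loop 0 {1, 2} (Move 0 MoveLeft)) (2 * length xs + 3) (memory (input_at xs ys) t s f b d a)
    (memory (shift MoveLeft (input_at [] (xs @ ys))) t s f b d a)"
proof (induction xs arbitrary: ys rule: rev_induct)
  case Nil
  then obtain y ys' where ys: "ys = y # ys'" by (cases ys) auto
  have stop: "runs (Loop 0 {1, 2} (Move 0 MoveLeft)) 1 (memory (shift MoveLeft (input_at [] ys)) t s f b d a)
     (memory (shift MoveLeft (input_at [] ys)) t s f b d a)"
    by (rule runs_LoopF) (auto simp: read_tape_def shift_def input_at_def input_tape_def)
  show ?case
    by (rule runs_LoopT[where T = 1 and T' = 1 and m' = "memory (shift MoveLeft (input_at [] ys)) t s f b d a"])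
      (use ys stop in auto)
next
  case (snoc x xs)
  then obtain y ys' where ys: "ys = y # ys'" by (cases ys) auto
  show ?case
    by (rule runs_LoopT[where T = 1 and T' = "2 * length xs + 3"
        and m' = "memory (input_at xs (x # ys)) t s f b d a"])
      (use snoc.IH[of "x # ys"] ys in auto)
qed

lemma runs_skip_block:
  assumes "ys = [] \<or> \<not> hd ys"
  shows "runs (Loop 0 {2} (Move 0 MoveRight)) (2 * n + 1)
    (memory (input_at xs (replicate n True @ ys)) t s f b d a)
    (memory (input_at (xs @ replicate n True) ys) t s f b d a)"
proof (induction n arbitrary: xs)
  case 0
  then show ?case using assms by (cases ys) (auto intro!: runs_LoopF)
next
  case (Suc n)
  show ?case
    by (rule runs_LoopT[where T = 1 and T' = "2 * n + 1"
        and m' = "memory (input_at (xs @ [True]) (replicate n True @ ys)) t s f b d a"])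
      (use Suc.IH[of "xs @ [True]"] in auto)
qed

lemma runs_restart:
  assumes w: "xs @ ys = encode_nat n @ w" "xs \<noteq> []"
  shows "runs restart (2 * length xs + 2 * n + 7) (memory (input_at xs ys) t s f b d a)
    (memory (input_at (encode_nat n) w) t s f b d a)"
proof -
  obtain xs' x where xs: "xs = xs' @ [x]" using w(2) by (cases xs rule: rev_cases) auto
  have eq: "xs' @ x # ys = replicate n True @ False # w"
    using w(1) by (simp add: xs encode_nat_def)
  have 1: "runs (Loop 0 {1, 2} (Move 0 MoveLeft)) (2 * length xs' + 3)
     (memory (input_at xs' (x # ys)) t s f b d a)
     (memory (shift MoveLeft (input_at [] (replicate n True @ False # w))) t s f b d a)"
    unfolding eq[symmetric] by (rule runs_rewind_input) simp
  have shift: "shift MoveRight (shift MoveLeft t) = t" for t by (simp add: shift_def)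
  have 2: "runs (Loop 0 {2} (Move 0 MoveRight) ;; Move 0 MoveRight) (2 * n + 1 + 1)
     (memory (input_at [] (replicate n True @ False # w)) t s f b d a)
     (memory (input_at (encode_nat n) w) t s f b d a)"
    by (rule runs_Seq[OF runs_skip_block]) (auto simp: encode_nat_def)
  have "runs (Loop 0 {1, 2} (Move 0 MoveLeft) ;; Move 0 MoveRight ;;
     Loop 0 {2} (Move 0 MoveRight) ;; Move 0 MoveRight) (2 * length xs + 2 * n + 7 - 1)
     (memory (input_at xs' (x # ys)) t s f b d a)
     (memory (input_at (encode_nat n) w) t s f b d a)"
    by (rule runs_Seq[OF 1, where T' = "2 * n + 3"]) (use 2 in \<open>auto simp: xs shift\<close>)
  then show ?thesis by (simp add: restart_def xs)
qed

section \<open>Greedy search from one start vertex\<close>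

text \<open>
  The marks between two passes when \<open>vs\<close> is the path built so far; its last vertex is current.
\<close>

definition status :: "nat \<Rightarrow> nat list \<Rightarrow> nat \<Rightarrow> nat" where
  "status n vs j = (if n \<le> j then 0 else if j = last vs then 2 else if j \<in> set vs then 1 else 3)"

text \<open>
  The marks after a pass that found no candidate.
\<close>

definition final_status :: "nat \<Rightarrow> nat list \<Rightarrow> nat \<Rightarrow> nat" where
  "final_status n vs j = (if n \<le> j then 0 else if j \<in> set vs then 1 else 3)"

text \<open>
  The arcs along which the path \<open>vs\<close> can be continued, with multiplicity.
\<close>

definition exits :: "nat \<Rightarrow> (nat \<times> nat) list \<Rightarrow> nat list \<Rightarrow> (nat \<times> nat) list" where
  "exits n es vs = filter (\<lambda>e. fst e = last vs \<and> snd e < n \<and> snd e \<notin> set vs) es"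

text \<open>
  What a pass over the arcs rejects apart from a second exit: arcs that are out of range, and loops
  at the last vertex of \<open>vs\<close>. A loop at another vertex is noticed when that vertex is the last one.
\<close>

definition defective :: "nat \<Rightarrow> (nat \<times> nat) list \<Rightarrow> nat list \<Rightarrow> bool" where
  "defective n es vs \<longleftrightarrow>
     (\<exists>e\<in>set es. n \<le> fst e \<or> n \<le> snd e \<or> fst e = last vs \<and> snd e = last vs)"

lemma marking_status: "marking n (status n vs)" "marking n (final_status n vs)"
  by (auto simp: marking_def status_def final_status_def)

lemma exitsD: "exits n es vs = e # es' \<Longrightarrow> fst e = last vs \<and> snd e < n \<and> snd e \<notin> set vs"
  by (auto simp: exits_def dest!: filter_eq_ConsD)

text \<open>
  A pass marks the head of the first exit as candidate, and fails if there is a second exit.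
\<close>

lemma fold_arc_step:
  assumes "vs \<noteq> []" "set vs \<subseteq> {..<n}"
  shows "fold arc_step es (status n vs, f, False) =
    (case exits n es vs of [] \<Rightarrow> status n vs | e # _ \<Rightarrow> (status n vs)(snd e := 4),
     f \<or> defective n es vs \<or> 2 \<le> length (exits n es vs), exits n es vs \<noteq> [])"
proof (induction es rule: rev_induct)
  case Nil
  then show ?case by (simp add: exits_def defective_def)
next
  case (snoc e es)
  have last: "last vs < n" "last vs \<in> set vs" using subsetD[OF assms(2) last_in_set[OF assms(1)]] assms(1) by auto
  have exits: "exits n (es @ [e]) vs = exits n es vs @
     (if fst e = last vs \<and> snd e < n \<and> snd e \<notin> set vs then [e] else [])"
    by (simp add: exits_def)
  have defective: "defective n (es @ [e]) vs \<longleftrightarrow> defective n es vs \<or>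
     n \<le> fst e \<or> n \<le> snd e \<or> fst e = last vs \<and> snd e = last vs"
    by (auto simp: defective_def)
  have step: "fold arc_step (es @ [e]) (status n vs, f, False) =
      arc_step e (fold arc_step es (status n vs, f, False))" by simp
  show ?case
  proof (cases "exits n es vs")
    case Nil
    then show ?thesis
      unfolding step snoc using last by (auto simp: exits defective arc_step_def arc_fails_def arc_hits_def status_def)
  next
    case (Cons e0 es0)
    then show ?thesis
      unfolding step snoc using last exitsD[OF Cons]
      by (auto simp: exits defective arc_step_def arc_fails_def arc_hits_def status_def)
  qed
qed

lemma advance_status:
  assumes "vs \<noteq> []" "set vs \<subseteq> {..<n}"
  shows "advance_symbol \<circ> status n vs = final_status n vs"
    and "y < n \<Longrightarrow> y \<notin> set vs \<Longrightarrow>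
      advance_symbol \<circ> (status n vs)(y := 4) = status n (vs @ [y])"
  using assms by (auto simp: fun_eq_iff advance_symbol_def status_def final_status_def)

lemma runs_pass:
  assumes w: "xs @ ys = encode_nat n @ w" "xs \<noteq> []" and reads: "reads w es m"
    and vs: "vs \<noteq> []" "set vs \<subseteq> {..<n}"
    and N: "N = length (encode_nat n @ w)"
  shows "runs pass (60 * N + 20) (memory (input_at xs ys) (marks 0 (status n vs)) s f b False a)
    (memory (input_at (encode_nat n @ w) [])
       (marks 0 (case exits n es vs of [] \<Rightarrow> final_status n vs | e # _ \<Rightarrow> status n (vs @ [snd e]))) s
       (f \<or> m \<or> defective n es vs \<or> 2 \<le> length (exits n es vs)) (exits n es vs \<noteq> []) False a)"
proof -
  let ?st = "case exits n es vs of [] \<Rightarrow> status n vs | e # _ \<Rightarrow> (status n vs)(snd e := 4)"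
  let ?f = "(f \<or> defective n es vs \<or> 2 \<le> length (exits n es vs)) \<or> m"
  let ?b = "exits n es vs \<noteq> []"
  have st: "marking n ?st"
    using marking_status(1)[of n vs] by (auto split: list.split dest: exitsD intro!: marking_update)
  have adv: "advance_symbol \<circ> ?st =
      (case exits n es vs of [] \<Rightarrow> final_status n vs | e # _ \<Rightarrow> status n (vs @ [snd e]))"
    using exitsD by (auto split: list.split simp: advance_status[OF vs])
  have "length xs \<le> N" using arg_cong[OF w(1), of length] N by simp
  moreover have "n + length w < N" by (simp add: N length_encode_nat)
  ultimately have time: "2 * length xs + 2 * n + 7 + (40 * length w + 1 + (7 * n + 4)) \<le> 60 * N + 20 - 1" by simp
  have "runs (restart ;; scan ;; advance) (60 * N + 20 - 1)
      (memory (input_at xs ys) (marks 0 (status n vs)) s f False False a)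
      (memory (input_at (encode_nat n @ w) []) (marks 0 (advance_symbol \<circ> ?st)) s ?f ?b False a)"
    by (rule runs_Seq[OF runs_restart[OF w] runs_Seq[OF runs_scan[OF reads marking_status(1)
      fold_arc_step[OF vs]] runs_advance[OF st] order_refl] time])
  then show ?thesis
    unfolding adv by (simp add: pass_def disj_commute disj_left_commute)
qed

text \<open>
  The greedy path \<open>vs\<close> continues along \<open>ys\<close> without failure and ends with all vertices visited.
\<close>

fun extends :: "nat \<Rightarrow> (nat \<times> nat) list \<Rightarrow> nat list \<Rightarrow> nat list \<Rightarrow> bool" where
  "extends n es vs [] \<longleftrightarrow> \<not> defective n es vs \<and> exits n es vs = [] \<and> {..<n} \<subseteq> set vs"
| "extends n es vs (y # ys) \<longleftrightarrow>
     \<not> defective n es vs \<and> exits n es vs = [(last vs, y)] \<and> extends n es (vs @ [y]) ys"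

text \<open>
  A start vertex that fails is not abandoned: the passes go on until no exit is left, with the fail
  flag set. At most \<open>n\<close> passes are made, since each but the last one visits a new vertex.
\<close>

lemma runs_greedy:
  assumes w: "xs @ ys = encode_nat n @ w" "xs \<noteq> []" and reads: "reads w es m"
    and vs: "vs \<noteq> []" "set vs \<subseteq> {..<n}" "distinct vs"
    and N: "N = length (encode_nat n @ w)"
  shows "\<exists>vs' f'. runs (Loop 4 {1} pass) ((Suc n - length vs) * (60 * N + 21) + 1)
      (memory (input_at xs ys) (marks 0 (status n vs)) s f True False a)
      (memory (input_at (encode_nat n @ w) []) (marks 0 (final_status n vs')) s f' False False a) \<and>
    (\<not> f' \<and> {..<n} \<subseteq> set vs' \<longleftrightarrow> \<not> f \<and> \<not> m \<and> (\<exists>zs. extends n es vs zs))"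
  using w vs
proof (induction "n - length vs" arbitrary: vs f xs ys rule: less_induct)
  case less
  let ?f = "f \<or> m \<or> defective n es vs \<or> 2 \<le> length (exits n es vs)"
  have len: "length vs \<le> n"
    using card_mono[OF _ less.prems(4)] distinct_card[OF less.prems(5)] by simp
  note pass = runs_pass[OF less.prems(1,2) reads less.prems(3,4) N]
  show ?case
  proof (cases "exits n es vs")
    case Nil
    have "extends n es vs zs \<Longrightarrow> zs = []" for zs using Nil by (cases zs) auto
    then have "(\<exists>zs. extends n es vs zs) \<longleftrightarrow> \<not> defective n es vs \<and> {..<n} \<subseteq> set vs"
      using Nil by (metis extends.simps(1))
    moreover have "runs (Loop 4 {1} pass) ((Suc n - length vs) * (60 * N + 21) + 1)
      (memory (input_at xs ys) (marks 0 (status n vs)) s f True False a)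
      (memory (input_at (encode_nat n @ w) []) (marks 0 (final_status n vs)) s ?f False False a)"
      by (rule runs_LoopT[OF _ pass, where T' = 1])
        (use len Nil in \<open>auto simp: Suc_diff_le intro!: runs_LoopF\<close>)
    ultimately show ?thesis
      using Nil by (intro exI[of _ vs] exI[of _ ?f]) auto
  next
    case (Cons e es')
    obtain y where y: "e = (last vs, y)" "y < n" "y \<notin> set vs"
      using exitsD[OF Cons] by (cases e) auto
    have "n - length (vs @ [y]) < n - length vs"
      using card_mono[of "{..<n}" "set (vs @ [y])"] distinct_card[of "vs @ [y]"] less.prems y by simp
    from less.hyps[OF this, of "encode_nat n @ w" "[]" ?f] y less.prems
    obtain vs' f' where IH: "runs (Loop 4 {1} pass) ((Suc n - length (vs @ [y])) * (60 * N + 21) + 1)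
      (memory (input_at (encode_nat n @ w) []) (marks 0 (status n (vs @ [y]))) s ?f True False a)
      (memory (input_at (encode_nat n @ w) []) (marks 0 (final_status n vs')) s f' False False a)"
      "\<not> f' \<and> {..<n} \<subseteq> set vs' \<longleftrightarrow> \<not> ?f \<and> \<not> m \<and> (\<exists>zs. extends n es (vs @ [y]) zs)"
      by (auto simp: encode_nat_def)
    have "extends n es vs zs \<longleftrightarrow> \<not> defective n es vs \<and> es' = [] \<and>
        (\<exists>zs'. zs = y # zs' \<and> extends n es (vs @ [y]) zs')" for zs
      using Cons y by (cases zs) auto
    then have "(\<exists>zs. extends n es vs zs) \<longleftrightarrow> \<not> defective n es vs \<and> es' = [] \<and>
        (\<exists>zs. extends n es (vs @ [y]) zs)" by auto
    moreover have "2 \<le> length (exits n es vs) \<longleftrightarrow> es' \<noteq> []"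
      using Cons by (cases es') auto
    ultimately have iff: "\<not> f' \<and> {..<n} \<subseteq> set vs' \<longleftrightarrow> \<not> f \<and> \<not> m \<and> (\<exists>zs. extends n es vs zs)"
      using IH(2) by auto
    have "Suc n - length vs = Suc (Suc n - length (vs @ [y]))" using len by simp
    then have time: "Suc (60 * N + 20 + ((Suc n - length (vs @ [y])) * (60 * N + 21) + 1)) \<le>
        (Suc n - length vs) * (60 * N + 21) + 1" by simp
    have st: "(case exits n es vs of [] \<Rightarrow> final_status n vs | e # _ \<Rightarrow> status n (vs @ [snd e])) =
        status n (vs @ [y])" "exits n es vs \<noteq> [] \<longleftrightarrow> True"
      using Cons y by auto
    have "runs (Loop 4 {1} pass) ((Suc n - length vs) * (60 * N + 21) + 1)
      (memory (input_at xs ys) (marks 0 (status n vs)) s f True False a)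
      (memory (input_at (encode_nat n @ w) []) (marks 0 (final_status n vs')) s f' False False a)"
      by (rule runs_LoopT[OF _ pass[unfolded st] IH(1) time]) simp
    with iff show ?thesis by blast
  qed
qed

section \<open>All start vertices\<close>

abbreviation unary :: "nat \<Rightarrow> nat \<Rightarrow> nat" where
  "unary n j \<equiv> of_bool (j < n)"

lemma runs_place:
  assumes "marking n st" "v < n"
  shows "runs place (6 * n + 9) (memory x (marks 0 st) (marks (Suc v) (unary n)) f b d a)
    (memory x (marks 0 (st(v := 2))) (marks (Suc v) (unary n)) f b d a)"
proof -
  let ?down = "\<lambda>k. memory x (marks k st) (marks (Suc v - k) (unary n)) f b d a"
  let ?up = "\<lambda>k. memory x (marks (Suc v - k) (st(v := 2))) (marks k (unary n)) f b d a"
  have 1: "runs (Loop 2 {1} (Move 2 MoveLeft ;; Move 1 MoveRight)) (Suc v * Suc 2 + 1) (?down 0) (?down (Suc v))"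
  proof (rule runs_Loop_iterate)
    fix k assume "k < Suc v"
    then have "Suc v - k = Suc (v - k)" by simp
    then show "read_tape (?down k 2) \<in> {1}"
      "runs (Move 2 MoveLeft ;; Move 1 MoveRight) 2 (?down k) (?down (Suc k))"
      using assms(2) by auto
  qed simp
  have 2: "runs (Loop 1 (- {0}) (Move 1 MoveLeft ;; Move 2 MoveRight)) (Suc v * Suc 2 + 1) (?up 0) (?up (Suc v))"
  proof (rule runs_Loop_iterate)
    fix k assume "k < Suc v"
    then have "Suc v - k = Suc (v - k)" by simp
    then show "read_tape (?up k 1) \<in> - {0}"
      "runs (Move 1 MoveLeft ;; Move 2 MoveRight) 2 (?up k) (?up (Suc k))"
      using assms marking_eq_0[OF assms(1), of "v - k"] by auto
  qed simp
  have "runs (Write 1 2 ;; Loop 1 (- {0}) (Move 1 MoveLeft ;; Move 2 MoveRight)) (Suc v * Suc 2 + 2)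
      (?down (Suc v)) (?up (Suc v))"
    using 2 by simp
  then have "runs place (6 * n + 9) (?down 0) (?up (Suc v))"
    unfolding place_def by (rule runs_Seq[OF 1]) (use assms(2) in simp)
  then show ?thesis by simp
qed

lemma runs_try_start:
  assumes w: "xs @ ys = encode_nat n @ w" "xs \<noteq> []" and reads: "reads w es m"
    and v: "v < n" and st: "marking n st"
    and N: "N = length (encode_nat n @ w)"
  shows "\<exists>st' f' a'. marking n st' \<and> (a' \<longleftrightarrow> a \<or> \<not> m \<and> (\<exists>zs. extends n es [v] zs)) \<and>
    runs try_start (60 * N * N + 60 * N + 40)
      (memory (input_at xs ys) (marks 0 st) (marks (Suc v) (unary n)) f False False a)
      (memory (input_at (encode_nat n @ w) []) (marks 0 st') (marks (Suc v) (unary n)) f' False False a')"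
proof -
  let ?m = "\<lambda>x st f b a. memory x (marks 0 st) (marks (Suc v) (unary n)) f b False a"
  let ?new = "\<lambda>j. if j < n then 3 else 0 :: nat"
  let ?x = "input_at xs ys" and ?y = "input_at (encode_nat n @ w) []"
  have new: "marking n ?new" by (simp add: marking_def)
  have nN: "n < N" by (simp add: N length_encode_nat)
  have 1: "runs (sweep (Write 1 3)) (n * (1 + 4) + 4) (?m ?x st f False a) (?m ?x ?new f False a)"
  proof (rule runs_sweep[OF st new, where f = "\<lambda>_. f"])
    fix i assume "i < n"
    then have "(\<lambda>j. if j < Suc i then ?new j else st j) = (\<lambda>j. if j < i then ?new j else st j)(i := 3)"
      by (auto simp: fun_eq_iff less_Suc_eq)
    then show "runs (Write 1 3) 1
        (memory ?x (marks (Suc i) (\<lambda>j. if j < i then ?new j else st j)) (marks (Suc v) (unary n)) f False False a)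
        (memory ?x (marks (Suc i) (\<lambda>j. if j < Suc i then ?new j else st j)) (marks (Suc v) (unary n)) f False False a)"
      by (simp del: fun_upd_apply)
  qed
  have start: "?new(v := 2) = status n [v]"
    using v by (auto simp: fun_eq_iff status_def)
  have 2: "runs place (6 * n + 9) (?m ?x ?new f False a) (?m ?x (status n [v]) f False a)"
    using runs_place[OF new v] unfolding start .
  obtain vs f1 where 3: "runs (Loop 4 {1} pass) ((Suc n - length [v]) * (60 * N + 21) + 1)
      (?m ?x (status n [v]) False True a) (?m ?y (final_status n vs) f1 False a)"
    and iff: "\<not> f1 \<and> {..<n} \<subseteq> set vs \<longleftrightarrow> \<not> m \<and> (\<exists>zs. extends n es [v] zs)"
    using runs_greedy[OF w reads _ _ _ N, where vs = "[v]" and s = "marks (Suc v) (unary n)"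
        and f = False and a = a] v by auto
  let ?f = "\<lambda>i. f1 \<or> (\<exists>j<i. final_status n vs j = 3)"
  have 4: "runs (sweep (Cond 1 {3} (Write 3 1) Skip)) (n * (2 + 4) + 4)
      (?m ?y (final_status n vs) (?f 0) False a) (?m ?y (final_status n vs) (?f n) False a)"
  proof (rule runs_sweep[OF marking_status(2) marking_status(2), where f = ?f])
    fix i
    have "?f (Suc i) \<longleftrightarrow> ?f i \<or> final_status n vs i = 3" by (auto simp: less_Suc_eq)
    then show "runs (Cond 1 {3} (Write 3 1) Skip) 2
        (memory ?y (marks (Suc i) (\<lambda>j. if j < i then final_status n vs j else final_status n vs j))
          (marks (Suc v) (unary n)) (?f i) False False a)
        (memory ?y (marks (Suc i) (\<lambda>j. if j < Suc i then final_status n vs j else final_status n vs j))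
          (marks (Suc v) (unary n)) (?f (Suc i)) False False a)"
      by (cases "final_status n vs i = 3") simp_all
  qed
  have unvisited: "(\<exists>j<n. final_status n vs j = 3) \<longleftrightarrow> \<not> {..<n} \<subseteq> set vs"
    by (auto simp: final_status_def subset_eq not_le)
  let ?a = "a \<or> \<not> ?f n"
  have 5: "runs (Cond 3 {0} (Write 6 1) Skip) 2 (?m ?y (final_status n vs) (?f n) False a)
      (?m ?y (final_status n vs) (?f n) False ?a)"
  proof -
    have "runs (Cond 3 {0} (Write 6 1) Skip) 2 (memory x t s g False False a)
        (memory x t s g False False (a \<or> \<not> g))" for x t s g
      by (cases g) simp_all
    then show ?thesis .
  qed
  have "n * (60 * N + 21) \<le> N * (60 * N + 21)" using nN by (intro mult_right_mono) auto
  then have time: "n * (1 + 4) + 4 + (6 * n + 9 + (2 + ((Suc n - length [v]) * (60 * N + 21) + 1 + (n * (2 + 4) + 4 + 2))))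
      \<le> 60 * N * N + 60 * N + 40"
    using nN by (simp add: algebra_simps)
  have 6: "runs (Write 3 0 ;; Write 4 1 ;; Loop 4 {1} pass ;; sweep (Cond 1 {3} (Write 3 1) Skip) ;;
        Cond 3 {0} (Write 6 1) Skip)
      (2 + ((Suc n - length [v]) * (60 * N + 21) + 1 + (n * (2 + 4) + 4 + 2)))
      (?m ?x (status n [v]) f False a) (?m ?y (final_status n vs) (?f n) False ?a)"
    using runs_Seq[OF 3 runs_Seq[OF 4[simplified] 5 order_refl] order_refl] by simp
  have "runs try_start (60 * N * N + 60 * N + 40) (?m ?x st f False a)
      (?m ?y (final_status n vs) (?f n) False ?a)"
    unfolding try_start_def by (rule runs_Seq[OF 1 runs_Seq[OF 2 6 order_refl] time])
  then show ?thesis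
    using marking_status(2) iff unvisited
    by (intro exI[of _ "final_status n vs"] exI[of _ "?f n"] exI[of _ ?a]) auto
qed

text \<open>
  The head of tape \<open>2\<close> on cell \<open>k\<close> means that the start vertices below \<open>k\<close> are still to be tried. For
  \<open>k = 0\<close> the input is not read again, so its head may then be at the beginning.
\<close>

lemma runs_try_all:
  assumes reads: "reads w es m" and N: "N = length (encode_nat n @ w)"
    and "xs @ ys = encode_nat n @ w" "xs \<noteq> [] \<or> k = 0" "k \<le> n" "marking n st"
  shows "\<exists>m'. (read_tape (m' 6) = 1 \<longleftrightarrow> a \<or> \<not> m \<and> (\<exists>v<k. \<exists>zs. extends n es [v] zs)) \<and>
    runs (Loop 2 {1} (try_start ;; Move 2 MoveLeft)) (k * (60 * N * N + 60 * N + 42) + 1)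
      (memory (input_at xs ys) (marks 0 st) (marks k (unary n)) f False False a) m'"
  using assms(3-)
proof (induction k arbitrary: xs ys st f a)
  case 0
  then show ?case
    by (intro exI[of _ "memory (input_at xs ys) (marks 0 st) (marks 0 (unary n)) f False False a"])
      (auto intro!: runs_LoopF)
next
  case (Suc k)
  then have k: "k < n" "xs \<noteq> []" by auto
  obtain st' f' a' where try_st: "marking n st'" "a' \<longleftrightarrow> a \<or> \<not> m \<and> (\<exists>zs. extends n es [k] zs)"
    "runs try_start (60 * N * N + 60 * N + 40)
      (memory (input_at xs ys) (marks 0 st) (marks (Suc k) (unary n)) f False False a)
      (memory (input_at (encode_nat n @ w) []) (marks 0 st') (marks (Suc k) (unary n)) f' False False a')"
    using runs_try_start[OF Suc.prems(1) k(2) reads k(1) Suc.prems(4) N, of a f] by blast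
  obtain m' where m': "read_tape (m' 6) = 1 \<longleftrightarrow> a' \<or> \<not> m \<and> (\<exists>v<k. \<exists>zs. extends n es [v] zs)"
    "runs (Loop 2 {1} (try_start ;; Move 2 MoveLeft)) (k * (60 * N * N + 60 * N + 42) + 1)
      (memory (input_at (encode_nat n @ w) []) (marks 0 st') (marks k (unary n)) f' False False a') m'"
    using Suc.IH[of "encode_nat n @ w" "[]" st' a' f'] k try_st(1) by (auto simp: encode_nat_def)
  have body: "runs (try_start ;; Move 2 MoveLeft) (60 * N * N + 60 * N + 41)
      (memory (input_at xs ys) (marks 0 st) (marks (Suc k) (unary n)) f False False a)
      (memory (input_at (encode_nat n @ w) []) (marks 0 st') (marks k (unary n)) f' False False a')"
    by (rule runs_Seq[OF try_st(3), where T' = 1]) auto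
  have "runs (Loop 2 {1} (try_start ;; Move 2 MoveLeft)) (Suc k * (60 * N * N + 60 * N + 42) + 1)
      (memory (input_at xs ys) (marks 0 st) (marks (Suc k) (unary n)) f False False a) m'"
    by (rule runs_LoopT[OF _ body m'(2)]) (use k in auto)
  then show ?case
    using m'(1) try_st(2) by (intro exI[of _ m']) (auto simp: less_Suc_eq)
qed

text \<open>
  The encodings of digraphs on which the greedy search succeeds from some start vertex.
\<close>

definition accepts :: "bool list \<Rightarrow> bool" where
  "accepts w \<longleftrightarrow> (\<exists>n es. w = encode_digraph n es \<and> (\<exists>v<n. \<exists>zs. extends n es [v] zs))"

lemma encode_digraph_eq: "encode_digraph n es = encode_nat n @ encode_arcs es"
  by (simp add: encode_digraph_def)

lemma runs_decide:
  assumes N: "N = length w"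
  shows "\<exists>m'. (read_tape (m' 6) = 1 \<longleftrightarrow> accepts w) \<and>
    runs decide (N * (60 * N * N + 60 * N + 42) + 8 * N + 5)
      (memory (input_tape w) blank_tape blank_tape False False False False) m'"
proof -
  obtain n r where w: "w = replicate n True @ r" and r: "r = [] \<or> (\<exists>w'. r = False # w')"
    using split_block by blast
  have nN: "n \<le> N" by (simp add: N w)
  let ?new = "\<lambda>k j. if j < k then 3 else 0 :: nat"
  let ?F = "\<lambda>k. memory (input_at (replicate k True) (replicate (n - k) True @ r)) (marks k (?new k))
      (marks k (unary k)) False False False False"
  let ?c = "Move 0 MoveRight ;; Move 1 MoveRight ;; Write 1 3 ;; Move 2 MoveRight ;; Write 2 1"
  have new: "(?new k)(k := 3) = ?new (Suc k)" "(unary k)(k := Suc 0) = unary (Suc k)" for k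
    by (auto simp: fun_eq_iff)
  have 1: "runs (Loop 0 {2} ?c) (n * Suc 5 + 1) (?F 0) (?F n)"
  proof (rule runs_Loop_iterate)
    fix k assume "k < n"
    then have "n - k = Suc (n - Suc k)" by simp
    then show "read_tape (?F k 0) \<in> {2}" "runs ?c 5 (?F k) (?F (Suc k))"
      by (auto simp: new replicate_append_same simp del: fun_upd_apply)
  next
    show "read_tape (?F n 0) \<notin> {2}" using r by auto
  qed
  have marking: "marking n (?new n)" by (simp add: marking_def)
  let ?G = "memory (input_at (replicate n True) r) (marks 0 (?new n)) (marks n (unary n)) False False False False"
  have 2: "runs rewind_marks (2 * n + 1) (?F n) ?G"
    using runs_rewind_marks[OF marking order_refl] by simp
  let ?c' = "Cond 0 {1} (Loop 2 {1} (try_start ;; Move 2 MoveLeft)) Skip"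
  have 3: "\<exists>m'. (read_tape (m' 6) = 1 \<longleftrightarrow> accepts w) \<and> runs ?c' (N * (60 * N * N + 60 * N + 42) + 2) ?G m'"
  proof (cases r)
    case Nil
    have "\<not> accepts w"
      using w Nil replicate_True_ne[of n] by (auto simp: accepts_def encode_digraph_eq encode_nat_def)
    then show ?thesis by (intro exI[of _ ?G]) (auto simp: Nil)
  next
    case (Cons x w')
    then have w': "w = encode_nat n @ w'" using w r by (simp add: encode_nat_def)
    obtain es m where reads: "reads w' es m" using reads_exists by blast
    have "w = encode_digraph n' es' \<longleftrightarrow> n' = n \<and> w' = encode_arcs es'" for n' es'
      unfolding w' encode_digraph_eq by (auto simp: encode_nat_def replicate_False_append_eq)
    moreover have "encode_arcs es = encode_arcs es' \<longleftrightarrow> es = es'" for es'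
      using encode_digraph_inject[of n es n es'] unfolding encode_digraph_eq by simp
    then have "w' = encode_arcs es' \<longleftrightarrow> \<not> m \<and> es' = es" for es'
      using reads_encodes[OF reads] reads_malformed[OF reads] by (cases m) auto
    ultimately have accepts: "accepts w \<longleftrightarrow> \<not> m \<and> (\<exists>v<n. \<exists>zs. extends n es [v] zs)"
      by (auto simp: accepts_def)
    have "N = length (encode_nat n @ w')" "replicate n True @ r = encode_nat n @ w'"
      using N w' w by auto
    from runs_try_all[OF reads this _ order_refl marking, of False False]
    obtain m' where m': "read_tape (m' 6) = 1 \<longleftrightarrow> \<not> m \<and> (\<exists>v<n. \<exists>zs. extends n es [v] zs)"
      "runs (Loop 2 {1} (try_start ;; Move 2 MoveLeft)) (n * (60 * N * N + 60 * N + 42) + 1) ?G m'"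
      by auto
    have "n * (60 * N * N + 60 * N + 42) \<le> N * (60 * N * N + 60 * N + 42)"
      using nN by (rule mult_right_mono) simp
    then have "runs (Loop 2 {1} (try_start ;; Move 2 MoveLeft)) (N * (60 * N * N + 60 * N + 42) + 1) ?G m'"
      by (intro runs_mono[OF m'(2)]) simp
    then show ?thesis
      using m'(1) accepts r Cons by (intro exI[of _ m']) auto
  qed
  then obtain m' where m': "read_tape (m' 6) = 1 \<longleftrightarrow> accepts w"
    "runs ?c' (N * (60 * N * N + 60 * N + 42) + 2) ?G m'" by blast
  have "runs decide (N * (60 * N * N + 60 * N + 42) + 8 * N + 5) (?F 0) m'"
    unfolding decide_def by (rule runs_Seq[OF 1 runs_Seq[OF 2 m'(2) order_refl]]) (use nN in simp)
  moreover have "?F 0 = memory (input_tape w) blank_tape blank_tape False False False False"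
    by (simp add: input_tape_eq marks_blank w)
  ultimately show ?thesis using m'(1) by auto
qed

text \<open>
  The polynomial is the time bound of \<open>runs_decide\<close> plus one.
\<close>

lemma accepts_polynomial_time: "{w. accepts w} \<in> polynomial_time"
proof (rule polynomial_timeI[OF bounded_decide])
  fix w
  let ?p = "[:6, 50, 60, 60:] :: nat poly"
  obtain m' where m': "read_tape (m' 6) = 1 \<longleftrightarrow> accepts w"
    "runs decide (length w * (60 * length w * length w + 60 * length w + 42) + 8 * length w + 5)
      (memory (input_tape w) blank_tape blank_tape False False False False) m'"
    using runs_decide by blast
  have "poly ?p (length w) =
      Suc (length w * (60 * length w * length w + 60 * length w + 42) + 8 * length w + 5)"
    by (simp add: algebra_simps)
  moreover obtain t where t: "t \<le> length w * (60 * length w * length w + 60 * length w + 42) + 8 * length w + 5"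
    "exec decide t (memory (input_tape w) blank_tape blank_tape False False False False) m'"
    using m'(2) unfolding runs_def by blast
  ultimately have "t < poly ?p (length w)" by (simp only: less_Suc_eq_le)
  moreover have "map (memory (input_tape w) blank_tape blank_tape False False False False) [0..<7] =
      input_tape w # replicate (7 - 1) blank_tape"
    by (simp add: upt_rec bit_blank[symmetric] numeral_eq_Suc memory_def)
  ultimately show "\<exists>t m m'. t < poly ?p (length w) \<and> exec decide t m m' \<and>
      map m [0..<7] = input_tape w # replicate (7 - 1) blank_tape \<and>
      (read_tape (m' 6) = 1 \<longleftrightarrow> w \<in> {w. accepts w})"
    using m'(1) t(2) by (intro exI conjI) (assumption | simp)+
qed simp_all

section \<open>Greedy paths and left-going arcs\<close>

text \<open>
  A Hamiltonian ordering \<open>vs\<close> such that from each of its vertices the only arc to a later vertex goes to the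
  next one. Each \<open>take (Suc i) vs\<close> is then the path of the greedy search after \<open>i\<close> passes.
\<close>

definition greedy_path :: "nat \<Rightarrow> (nat \<times> nat) list \<Rightarrow> nat list \<Rightarrow> bool" where
  "greedy_path n es vs \<longleftrightarrow> vs \<noteq> [] \<and> distinct vs \<and> set vs = {..<n} \<and>
     (\<forall>i<length vs. exits n es (take (Suc i) vs) =
        (if Suc i < length vs then [(vs ! i, vs ! Suc i)] else []))"

text \<open>
  Unfolds \<open>extends\<close> along \<open>zs\<close>: the indices from \<open>length vs - 1\<close> on are those at which a prefix of
  \<open>vs @ zs\<close> reaches at least to the end of \<open>vs\<close>.
\<close>

lemma extends_iff:
  assumes "vs \<noteq> []"
  shows "extends n es vs zs \<longleftrightarrow> {..<n} \<subseteq> set (vs @ zs) \<and>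
    (\<forall>i\<in>{length vs - 1..<length (vs @ zs)}. \<not> defective n es (take (Suc i) (vs @ zs)) \<and>
       exits n es (take (Suc i) (vs @ zs)) =
         (if Suc i < length (vs @ zs) then [((vs @ zs) ! i, (vs @ zs) ! Suc i)] else []))"
  using assms
proof (induction zs arbitrary: vs)
  case Nil
  then have "{length vs - 1..<length vs} = {length vs - 1}" by (cases vs) auto
  with Nil show ?case by (auto simp: conj_commute)
next
  case (Cons z zs)
  obtain k where k: "length vs = Suc k" using Cons.prems by (cases vs) auto
  have int: "{length vs - 1..<length (vs @ z # zs)} =
      insert k {length (vs @ [z]) - 1..<length ((vs @ [z]) @ zs)}"
    by (auto simp: k)
  have "(vs @ z # zs) ! k = last vs" using Cons.prems k by (simp add: nth_append last_conv_nth)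
  moreover have "(vs @ z # zs) ! Suc k = z" using k by (simp add: nth_append)
  ultimately show ?case
    unfolding int using Cons.IH[of "vs @ [z]"] k by auto
qed

lemma exits_imp_distinct:
  assumes "\<And>i. Suc i < length vs \<Longrightarrow> exits n es (take (Suc i) vs) = [(vs ! i, vs ! Suc i)]"
  shows "distinct vs \<and> (vs \<noteq> [] \<and> vs ! 0 < n \<longrightarrow> set vs \<subseteq> {..<n})"
  using assms(1)
proof (induction vs rule: rev_induct)
  case (snoc x vs)
  have IH: "distinct vs \<and> (vs \<noteq> [] \<and> vs ! 0 < n \<longrightarrow> set vs \<subseteq> {..<n})"
  proof (rule snoc.IH)
    fix i assume "Suc i < length vs"
    then show "exits n es (take (Suc i) vs) = [(vs ! i, vs ! Suc i)]"
      using snoc.prems[of i] by (simp add: nth_append)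
  qed
  show ?case
  proof (cases vs rule: rev_cases)
    case (snoc vs' y)
    then have "exits n es vs = [(y, x)]"
      using snoc.prems[of "length vs'"] by (simp add: nth_append)
    then show ?thesis using IH exitsD[of n es vs] snoc by (auto simp: nth_append)
  qed auto
qed auto

lemma extends_iff_greedy_path:
  "(\<exists>v<n. \<exists>zs. extends n es [v] zs) \<longleftrightarrow>
   (\<forall>e\<in>set es. fst e < n \<and> snd e < n \<and> fst e \<noteq> snd e) \<and> (\<exists>vs. greedy_path n es vs)"
proof -
  have sound: "(\<forall>e\<in>set es. fst e < n \<and> snd e < n \<and> fst e \<noteq> snd e) \<longleftrightarrow>
      (\<forall>i<length vs. \<not> defective n es (take (Suc i) vs))"
    if vs: "vs \<noteq> []" "set vs = {..<n}" for vs
  proof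
    assume *: "\<forall>i<length vs. \<not> defective n es (take (Suc i) vs)"
    show "\<forall>e\<in>set es. fst e < n \<and> snd e < n \<and> fst e \<noteq> snd e"
    proof
      fix e assume e: "e \<in> set es"
      have nd: "\<not> defective n es (take (Suc 0) vs)" using * vs(1) by auto
      then have less: "fst e < n" "snd e < n" using e by (auto simp: defective_def not_le)
      then obtain i where "i < length vs" "vs ! i = fst e"
        using vs(2) by (metis in_set_conv_nth lessThan_iff)
      moreover from this have "last (take (Suc i) vs) = fst e" by (simp add: take_Suc_conv_app_nth)
      ultimately show "fst e < n \<and> snd e < n \<and> fst e \<noteq> snd e"
        using * e less by (fastforce simp: defective_def)
    qed
  qed (auto simp: defective_def)
  have "extends n es [v] zs \<longleftrightarrow> (\<forall>e\<in>set es. fst e < n \<and> snd e < n \<and> fst e \<noteq> snd e) \<and> greedy_path n es (v # zs)"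
    if v: "v < n" for v zs
  proof -
    let ?vs = "v # zs"
    let ?exits = "\<forall>i<length ?vs. exits n es (take (Suc i) ?vs) =
        (if Suc i < length ?vs then [(?vs ! i, ?vs ! Suc i)] else [])"
    have "extends n es [v] zs \<longleftrightarrow> {..<n} \<subseteq> set ?vs \<and> ?exits \<and> (\<forall>i<length ?vs. \<not> defective n es (take (Suc i) ?vs))"
    proof -
      have "{length [v] - 1..<length ([v] @ zs)} = {..<length ?vs}" by auto
      then show ?thesis
        unfolding extends_iff[OF list.distinct(2)] append_Cons append_Nil ball_conj_distrib
        by (auto simp only: Ball_def lessThan_iff)
    qed
    moreover have "distinct ?vs \<and> set ?vs \<subseteq> {..<n}" if "?exits"
      using exits_imp_distinct[of ?vs n es] that v by auto
    ultimately show ?thesis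
      using sound[of ?vs] unfolding greedy_path_def by (metis list.distinct(1) subset_antisym order_refl)
  qed
  moreover have "\<exists>v<n. \<exists>zs. vs = v # zs" if "greedy_path n es vs" for vs
    using that by (cases vs) (auto simp: greedy_path_def)
  ultimately show ?thesis by (metis (no_types, lifting))
qed

lemma digraph_of_simps [simp]:
  "verts (digraph_of n es) = {..<n}" "arcs (digraph_of n es) = {..<length es}"
  "tail (digraph_of n es) a = fst (es ! a)" "head (digraph_of n es) a = snd (es ! a)"
  by (simp_all add: digraph_of_def)

lemma loopfree_digraph_of:
  "fin_digraph (digraph_of n es) \<and> loopfree_digraph (digraph_of n es) \<longleftrightarrow>
   (\<forall>e\<in>set es. fst e < n \<and> snd e < n \<and> fst e \<noteq> snd e)"
  unfolding fin_digraph_def fin_digraph_axioms_def loopfree_digraph_def loopfree_digraph_axioms_def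
    wf_digraph_def
  by (auto simp: all_set_conv_all_nth)

context pre_digraph
begin

lemma cas_if_nth:
  assumes "length vs = Suc (length p)"
    and "\<And>i. i < length p \<Longrightarrow> tail G (p ! i) = vs ! i \<and> head G (p ! i) = vs ! Suc i"
  shows "cas (hd vs) p (last vs) \<and> awalk_verts (hd vs) p = vs"
  using assms
proof (induction p arbitrary: vs)
  case Nil
  then show ?case by (cases vs) auto
next
  case (Cons a p)
  then obtain v vs' where vs: "vs = v # vs'" "length vs' = Suc (length p)" by (cases vs) auto
  have "cas (hd vs') p (last vs') \<and> awalk_verts (hd vs') p = vs'"
    using Cons.prems(2)[of "Suc _"] vs by (intro Cons.IH) auto
  moreover have "tail G a = v" "head G a = hd vs'"
    using Cons.prems(2)[of 0] vs by (auto simp: hd_conv_nth) (cases vs'; simp)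
  ultimately show ?case using vs by auto
qed

lemma cas_nth:
  "cas u p v \<Longrightarrow> i < length p \<Longrightarrow>
   tail G (p ! i) = awalk_verts u p ! i \<and> head G (p ! i) = awalk_verts u p ! Suc i"
proof (induction p arbitrary: u i)
  case (Cons a p)
  have "awalk_verts (head G a) p ! 0 = head G a" using Cons.prems by (cases p) auto
  then show ?case using Cons by (cases i) auto
qed simp

end

lemma left_going_arcs_rev:
  "left_going_arcs G (rev vs) =
     {a \<in> arcs G. \<exists>i j. i < j \<and> j < length vs \<and> tail G a = vs ! i \<and> head G a = vs ! j}"
proof -
  have "(\<exists>i j. j < i \<and> i < length vs \<and> x = rev vs ! i \<and> y = rev vs ! j) \<longleftrightarrow>
      (\<exists>i j. i < j \<and> j < length vs \<and> x = vs ! i \<and> y = vs ! j)" for x y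
  proof safe
    fix i j assume "j < i" "i < length vs"
    then show "\<exists>i' j'. i' < j' \<and> j' < length vs \<and> rev vs ! i = vs ! i' \<and> rev vs ! j = vs ! j'"
      by (intro exI[of _ "length vs - Suc i"] exI[of _ "length vs - Suc j"]) (auto simp: rev_nth)
  next
    fix i j assume "i < j" "j < length vs"
    then show "\<exists>i' j'. j' < i' \<and> i' < length vs \<and> vs ! i = rev vs ! i' \<and> vs ! j = rev vs ! j'"
      by (intro exI[of _ "length vs - Suc i"] exI[of _ "length vs - Suc j"]) (auto simp: rev_nth)
  qed
  then show ?thesis by (simp add: left_going_arcs_def)
qed

lemma filter_eq_singletonI:
  assumes "{i. i < length xs \<and> P (xs ! i)} = {k}"
  shows "filter P xs = [xs ! k]"
proof -
  have "length (filter P xs) = 1" using assms by (simp add: length_filter_conv_card)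
  then obtain x where x: "filter P xs = [x]" by (auto simp: length_Suc_conv)
  then have "x \<in> set xs" "P x" using filter_set[of P xs] by auto
  then obtain i where "i < length xs" "xs ! i = x" by (auto simp: in_set_conv_nth)
  with \<open>P x\<close> assms have "i = k" by auto
  with x \<open>xs ! i = x\<close> show ?thesis by simp
qed

lemma filter_eq_singletonD:
  assumes "filter P xs = [x]" "i < length xs" "P (xs ! i)" "j < length xs" "P (xs ! j)"
  shows "i = j"
proof -
  have "card {i. i < length xs \<and> P (xs ! i)} = 1"
    using assms(1) by (simp flip: length_filter_conv_card)
  then obtain k where "{i. i < length xs \<and> P (xs ! i)} = {k}" by (auto simp: card_1_singleton_iff)
  then have "i = k" "j = k" using assms(2-) by blast+
  then show ?thesis by simp
qed

lemma last_take_Suc: "i < length vs \<Longrightarrow> last (take (Suc i) vs) = vs ! i"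
  by (simp add: take_Suc_conv_app_nth)

lemma nth_notin_set_take: "distinct vs \<Longrightarrow> i < j \<Longrightarrow> j < length vs \<Longrightarrow> vs ! j \<notin> set (take (Suc i) vs)"
  by (auto simp: in_set_conv_nth nth_eq_iff_index_eq)

text \<open>
  The reversed greedy path is the required ordering: its left-going arcs are the arcs from a vertex
  of the path to a later one.
\<close>

lemma greedy_path_left_going:
  assumes "greedy_path n es vs"
  shows "left_going_hamiltonian (digraph_of n es)"
proof -
  let ?G = "digraph_of n es"
  let ?P = "\<lambda>i e. fst e = last (take (Suc i) vs) \<and> snd e < n \<and> snd e \<notin> set (take (Suc i) vs)"
  have vs: "vs \<noteq> []" "distinct vs" "set vs = {..<n}"
    using assms by (auto simp: greedy_path_def)
  have exits: "filter (?P i) es = (if Suc i < length vs then [(vs ! i, vs ! Suc i)] else [])"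
    if "i < length vs" for i
    using assms that unfolding greedy_path_def exits_def by blast
  have "\<forall>i. \<exists>a. Suc i < length vs \<longrightarrow> a < length es \<and> es ! a = (vs ! i, vs ! Suc i)"
  proof
    fix i
    show "\<exists>a. Suc i < length vs \<longrightarrow> a < length es \<and> es ! a = (vs ! i, vs ! Suc i)"
    proof (cases "Suc i < length vs")
      case True
      then have "filter (?P i) es = [(vs ! i, vs ! Suc i)]" using exits[of i] by simp
      then have "(vs ! i, vs ! Suc i) \<in> set (filter (?P i) es)" by simp
      then show ?thesis by (auto simp: in_set_conv_nth)
    qed simp
  qed
  then obtain arc where arc: "\<And>i. Suc i < length vs \<Longrightarrow> arc i < length es \<and> es ! arc i = (vs ! i, vs ! Suc i)"
    by metis
  define p where "p = map arc [0..<length vs - 1]"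
  have p: "i < length p \<Longrightarrow> p ! i = arc i" "length vs = Suc (length p)" for i
    using vs(1) by (auto simp: p_def)
  have walk: "pre_digraph.cas ?G (hd vs) p (last vs)" "pre_digraph.awalk_verts ?G (hd vs) p = vs"
    using pre_digraph.cas_if_nth[of vs p ?G] p arc by auto
  have "hamiltonian_dipath ?G (hd vs) p (last vs)"
    using walk vs arc hd_in_set[OF vs(1)]
    by (auto simp: hamiltonian_dipath_def pre_digraph.apath_def pre_digraph.awalk_def p_def)
  moreover have "left_going_arcs ?G (rev vs) = set p"
  proof
    show "set p \<subseteq> left_going_arcs ?G (rev vs)"
    proof
      fix a assume "a \<in> set p"
      then obtain i where "i < length vs - 1" "a = arc i" by (auto simp: p_def)
      moreover from this have "Suc i < length vs" by simp
      ultimately show "a \<in> left_going_arcs ?G (rev vs)"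
        using arc[of i] by (simp add: left_going_arcs_rev) (use lessI in blast)
    qed
    show "left_going_arcs ?G (rev vs) \<subseteq> set p"
    proof
      fix a assume "a \<in> left_going_arcs ?G (rev vs)"
      then obtain i j where a: "a < length es" "es ! a = (vs ! i, vs ! j)" and ij: "i < j" "j < length vs"
        by (auto simp: left_going_arcs_rev prod_eq_iff)
      have P: "?P i (vs ! i, vs ! k)" if "i < k" "k < length vs" for k
        using that nth_notin_set_take[OF vs(2) that] vs(3) nth_mem[of k vs] by (auto simp: last_take_Suc)
      have "a = arc i"
        using filter_eq_singletonD[of "?P i" es, OF _ a(1) _ conjunct1[OF arc]] exits[of i] P[of j] P[of "Suc i"]
          arc[of i] a ij by auto
      then show "a \<in> set p" using ij by (auto simp: p_def)
    qed
  qed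
  moreover have "vertex_ordering ?G (rev vs)" using vs by (simp add: vertex_ordering_def)
  ultimately show ?thesis unfolding left_going_hamiltonian_def by blast
qed

text \<open>
  Along the path the positions in the ordering \<open>\<sigma>\<close> decrease, so every arc from a vertex of the path to a
  later one is left-going, hence an arc of the path.
\<close>

lemma left_going_greedy_path:
  assumes "left_going_hamiltonian (digraph_of n es)"
  shows "\<exists>vs. greedy_path n es vs"
proof -
  let ?G = "digraph_of n es"
  obtain \<sigma> u p v where \<sigma>: "distinct \<sigma>" "set \<sigma> = {..<n}" and ham: "hamiltonian_dipath ?G u p v"
    and left: "left_going_arcs ?G \<sigma> = set p"
    using assms by (auto simp: left_going_hamiltonian_def vertex_ordering_def)
  \<comment> \<open>the vertices of the path, in the order of the path\<close>
  define vs where "vs = pre_digraph.awalk_verts ?G u p"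
  have vs: "distinct vs" "set vs = {..<n}" "set p \<subseteq> {..<length es}" "pre_digraph.cas ?G u p v"
    using ham by (auto simp: vs_def hamiltonian_dipath_def pre_digraph.apath_def pre_digraph.awalk_def)
  have len: "length vs = Suc (length p)"
    by (simp add: vs_def pre_digraph.length_awalk_verts)
  have arc: "es ! (p ! i) = (vs ! i, vs ! Suc i)" if "i < length p" for i
    using pre_digraph.cas_nth[OF vs(4) that] by (simp add: vs_def prod_eq_iff)
  \<comment> \<open>positions in the ordering\<close>
  define pos where "pos = the_inv_into {..<length \<sigma>} ((!) \<sigma>)"
  have pos: "pos (\<sigma> ! i) = i" if "i < length \<sigma>" for i
    unfolding pos_def using that \<sigma>(1) by (intro the_inv_into_f_f inj_on_nth) auto
  have "pos (vs ! Suc i) < pos (vs ! i)" if "i < length p" for i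
  proof -
    have "p ! i \<in> left_going_arcs ?G \<sigma>" using that left by simp
    then show ?thesis using arc[OF that] pos by (auto simp: left_going_arcs_def)
  qed
  then have step: "pos (vs ! Suc i) < pos (vs ! i)" if "Suc i < length vs" for i
    using that len by simp
  have mono: "pos (vs ! j) < pos (vs ! i)" if "i < j" "j < length vs" for i j
    using that
  proof (induction j)
    case (Suc j)
    then show ?case using step[of j] by (cases "i = j") auto
  qed simp
  have exits: "exits n es (take (Suc i) vs) =
      (if Suc i < length vs then [(vs ! i, vs ! Suc i)] else [])" if i: "i < length vs" for i
  proof -
    let ?P = "\<lambda>e. fst e = last (take (Suc i) vs) \<and> snd e < n \<and> snd e \<notin> set (take (Suc i) vs)"
    have "a = p ! i \<and> i < length p" if a: "a < length es" "?P (es ! a)" for a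
    proof -
      from a(2) have "snd (es ! a) \<in> set vs" using vs(2) by auto
      then obtain j where j: "j < length vs" "snd (es ! a) = vs ! j" by (metis in_set_conv_nth)
      have "i < j"
      proof (rule ccontr)
        assume "\<not> i < j"
        then have "vs ! j \<in> set (take (Suc i) vs)"
          using j(1) by (auto simp: in_set_conv_nth intro!: exI[of _ j])
        with a(2) j(2) show False by simp
      qed
      then have less: "pos (vs ! j) < pos (vs ! i)" using j(1) by (rule mono)
      have ends: "fst (es ! a) = vs ! i" using a(2) i by (simp add: last_take_Suc)
      obtain k l where k: "k < length \<sigma>" "vs ! i = \<sigma> ! k" and l: "l < length \<sigma>" "vs ! j = \<sigma> ! l"
        using \<sigma>(2) vs(2) i j(1) nth_mem by (metis in_set_conv_nth)
      have "a \<in> left_going_arcs ?G \<sigma>"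
        using less a(1) ends j(2) k l pos by (auto simp: left_going_arcs_def)
      then obtain k where "k < length p" "a = p ! k" using left by (auto simp: in_set_conv_nth)
      moreover from this have "vs ! k = vs ! i" using arc[of k] ends by simp
      ultimately show ?thesis using vs(1) i len by (auto simp: nth_eq_iff_index_eq)
    qed
    moreover have "p ! i < length es \<and> ?P (es ! (p ! i))" if "i < length p"
      using that vs arc len nth_notin_set_take[of vs i "Suc i"] nth_mem[of "Suc i" vs]
        subsetD[OF vs(3) nth_mem[of i p]]
      by (auto simp: last_take_Suc)
    ultimately have set: "{a. a < length es \<and> ?P (es ! a)} = (if i < length p then {p ! i} else {})"
      by auto
    show ?thesis
    proof (cases "i < length p")
      case True
      then show ?thesis using filter_eq_singletonI[of es ?P "p ! i"] set arc len by (simp add: exits_def)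
    next
      case False
      then have "length (filter ?P es) = 0" using set by (simp add: length_filter_conv_card)
      then show ?thesis using False len by (simp add: exits_def)
    qed
  qed
  show ?thesis using vs len exits by (intro exI[of _ vs]) (auto simp: greedy_path_def)
qed

lemma left_going_hamiltonian_iff_extends:
  "fin_digraph (digraph_of n es) \<and> loopfree_digraph (digraph_of n es) \<and>
     left_going_hamiltonian (digraph_of n es) \<longleftrightarrow> (\<exists>v<n. \<exists>zs. extends n es [v] zs)"
  unfolding extends_iff_greedy_path conj_assoc[symmetric] loopfree_digraph_of
  using greedy_path_left_going left_going_greedy_path by blast

theorem theorem3p15:
  shows "left_going_hamiltonian_language \<in> polynomial_time"
proof -
  have "left_going_hamiltonian_language = {w. accepts w}"
    unfolding left_going_hamiltonian_language_def accepts_def left_going_hamiltonian_iff_extends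
    by blast
  then show ?thesis using accepts_polynomial_time by simp
qed

end
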